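(* Let $d\ge1$, let $\kappa\in\mathbb{R}^{d+1}$ with $\kappa_j>-1$ for all $j$, let $N$ be a positive integer and $n\in\{0,1,\ldots,N\}$. Then for all $x,y\in\mathbb{Z}_N^{d+1}$, $$\mathsf{P}_n(\mathsf{H}_{\kappa,N};x,y)=\frac{(-N)_n(|\kappa|+d+1)_N(|\kappa|+d+1)_n(|\kappa|+d+2n)}{n!\,(|\kappa|+d+1)_{N+n}(|\kappa|+d+n)}\sum_{k=0}^n\frac{(-n)_k(n+|\kappa|+d)_k}{(-N)_k(-N)_k}\,\mathcal{E}_k(x,y;\kappa),$$ where for $n=0$ the factor $(|\kappa|+d+2n)/(|\kappa|+d+n)$ is read as $1$.
   Context: Notation: $(a)_k=a(a+1)\cdots(a+k-1)$; for vectors, $|\cdot|$ is the sum of the components, $\gamma!=\prod_i\gamma_i!$, $(-x)_\gamma=\prod_i(-x_i)_{\gamma_i}$, $\mathbf 1=(1,\ldots,1)$, $(\kappa+\mathbf 1)_\gamma=\prod_{i=1}^{d+1}(\kappa_i+1)_{\gamma_i}$. $\mathbb{Z}_N^{d+1}=\{\alpha\in\mathbb{N}_0^{d+1}:|\alpha|=N\}$. Hahn inner product of functions on $\mathbb{Z}_N^{d+1}$: $$\langle f,g\rangle_{\mathsf{H}_{\kappa,N}}=\frac{N!}{(|\kappa|+d+1)_N}\sum_{\alpha\in\mathbb{Z}_N^{d+1}}f(\alpha)g(\alpha)\frac{(\kappa+\mathbf 1)_\alpha}{\alpha!},$$ normalized so that $\langle1,1\rangle=1$. A polynomial on $\mathbb{Z}_N^{d+1}$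 of degree at most $n$ is the restriction of a polynomial of total degree at most $n$ in the first $d$ coordinates. For $0\le n\le N$, $\mathcal{V}_n^d(\mathsf{H}_{\kappa,N})$ is the space of polynomials of degree at most $n$ on $\mathbb{Z}_N^{d+1}$ orthogonal to all polynomials of degree at most $n-1$. $\mathsf{P}_n(\mathsf{H}_{\kappa,N};x,y)$ is the reproducing kernel of $\mathcal{V}_n^d(\mathsf{H}_{\kappa,N})$: it lies in $\mathcal{V}_n^d(\mathsf{H}_{\kappa,N})$ in each variable and $\langle\mathsf{P}_n(\mathsf{H}_{\kappa,N};x,\cdot),Q\rangle_{\mathsf{H}_{\kappa,N}}=Q(x)$ for all $Q\in\mathcal{V}_n^d(\mathsf{H}_{\kappa,N})$. For $x,y\in\mathbb{Z}_N^{d+1}$, $\mathcal{E}_0(x,y;\kappa)=1$ and $$\mathcal{E}_k(x,y;\kappa)=\sum_{\gamma\in\mathbb{N}_0^{d+1},\,|\gamma|=k}\frac{(-x)_\gamma(-y)_\gamma}{(\kappa+\mathbf 1)_\gamma\,\gamma!},\qquad k=1,\ldots,N.$$ *)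

theory Defs
  imports Complex_Main
begin

text \<open>
  Vectors with \<open>m\<close> components are functions on \<open>nat\<close> of which the components \<open>i < m\<close> matter.
  Multi-indices vanish at all \<open>i \<ge> m\<close>, so that they are determined by their components.
  The coordinates \<open>1, \<dots>, d + 1\<close> of the mathematical text are numbered \<open>0, \<dots>, d\<close> here.
\<close>

definition multi_indices :: "nat \<Rightarrow> nat \<Rightarrow> (nat \<Rightarrow> nat) set" where
  "multi_indices m k = {\<gamma>. (\<forall>i\<ge>m. \<gamma> i = 0) \<and> (\<Sum>i<m. \<gamma> i) = k}"

abbreviation hahn_grid :: "nat \<Rightarrow> nat \<Rightarrow> (nat \<Rightarrow> nat) set" where
  "hahn_grid d N \<equiv> multi_indices (d + 1) N"

definition vsum :: "nat \<Rightarrow> (nat \<Rightarrow> real) \<Rightarrow> real" where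
  "vsum d \<kappa> = (\<Sum>i<d + 1. \<kappa> i)"

definition vpochhammer :: "nat \<Rightarrow> (nat \<Rightarrow> real) \<Rightarrow> (nat \<Rightarrow> nat) \<Rightarrow> real" where
  "vpochhammer d a \<gamma> = (\<Prod>i<d + 1. pochhammer (a i) (\<gamma> i))"

definition vfact :: "nat \<Rightarrow> (nat \<Rightarrow> nat) \<Rightarrow> real" where
  "vfact d \<gamma> = (\<Prod>i<d + 1. fact (\<gamma> i))"

definition hahn_inner ::
    "nat \<Rightarrow> (nat \<Rightarrow> real) \<Rightarrow> nat \<Rightarrow> ((nat \<Rightarrow> nat) \<Rightarrow> real) \<Rightarrow> ((nat \<Rightarrow> nat) \<Rightarrow> real) \<Rightarrow> real" where
  "hahn_inner d \<kappa> N f g =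
     fact N / pochhammer (vsum d \<kappa> + real d + 1) N *
     (\<Sum>\<alpha>\<in>hahn_grid d N. f \<alpha> * g \<alpha> * (vpochhammer d (\<lambda>i. \<kappa> i + 1) \<alpha> / vfact d \<alpha>))"

text \<open>
  A function on the grid is represented by any total function with the given values on the grid;
  its values elsewhere are irrelevant. The monomials below involve the first \<open>d\<close> of the
  \<open>d + 1\<close> coordinates only.
\<close>

definition grid_polys :: "nat \<Rightarrow> nat \<Rightarrow> nat \<Rightarrow> ((nat \<Rightarrow> nat) \<Rightarrow> real) set" where
  "grid_polys d N n =
     {f. \<exists>c. \<forall>\<alpha>\<in>hahn_grid d N.
        f \<alpha> = (\<Sum>\<gamma>\<in>(\<Union>k\<le>n. multi_indices d k). c \<gamma> * (\<Prod>i<d. real (\<alpha> i) ^ \<gamma> i))}"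

text \<open>
  Quantifying over all \<open>m < n\<close> instead of using \<open>n - 1\<close> makes the orthogonality condition
  void for \<open>n = 0\<close>, where truncated subtraction would go wrong.
\<close>

definition hahn_space :: "nat \<Rightarrow> (nat \<Rightarrow> real) \<Rightarrow> nat \<Rightarrow> nat \<Rightarrow> ((nat \<Rightarrow> nat) \<Rightarrow> real) set" where
  "hahn_space d \<kappa> N n =
     {f \<in> grid_polys d N n. \<forall>m<n. \<forall>g\<in>grid_polys d N m. hahn_inner d \<kappa> N f g = 0}"

definition is_hahn_kernel ::
    "nat \<Rightarrow> (nat \<Rightarrow> real) \<Rightarrow> nat \<Rightarrow> nat \<Rightarrow> ((nat \<Rightarrow> nat) \<Rightarrow> (nat \<Rightarrow> nat) \<Rightarrow> real) \<Rightarrow> bool" where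
  "is_hahn_kernel d \<kappa> N n K \<longleftrightarrow>
     (\<forall>y\<in>hahn_grid d N. (\<lambda>x. K x y) \<in> hahn_space d \<kappa> N n) \<and>
     (\<forall>x\<in>hahn_grid d N. (\<lambda>y. K x y) \<in> hahn_space d \<kappa> N n) \<and>
     (\<forall>x\<in>hahn_grid d N. \<forall>Q\<in>hahn_space d \<kappa> N n. hahn_inner d \<kappa> N (\<lambda>y. K x y) Q = Q x)"

text \<open>
  The reproducing kernel is a function on pairs of grid points. It is represented by its extension
  by \<open>0\<close>, which makes the description definite (see \<open>ex1_hahn_kernel\<close> below).
\<close>

definition hahn_kernel ::
    "nat \<Rightarrow> (nat \<Rightarrow> real) \<Rightarrow> nat \<Rightarrow> nat \<Rightarrow> (nat \<Rightarrow> nat) \<Rightarrow> (nat \<Rightarrow> nat) \<Rightarrow> real" where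
  "hahn_kernel d \<kappa> N n =
     (THE K. is_hahn_kernel d \<kappa> N n K \<and>
        (\<forall>x y. x \<notin> hahn_grid d N \<or> y \<notin> hahn_grid d N \<longrightarrow> K x y = 0))"

text \<open>For \<open>k = 0\<close> the sum has the single term \<open>1\<close>.\<close>

definition hahn_E ::
    "nat \<Rightarrow> (nat \<Rightarrow> real) \<Rightarrow> nat \<Rightarrow> (nat \<Rightarrow> nat) \<Rightarrow> (nat \<Rightarrow> nat) \<Rightarrow> real" where
  "hahn_E d \<kappa> k x y =
     (\<Sum>\<gamma>\<in>multi_indices (d + 1) k.
        vpochhammer d (\<lambda>i. - real (x i)) \<gamma> * vpochhammer d (\<lambda>i. - real (y i)) \<gamma> /
        (vpochhammer d (\<lambda>i. \<kappa> i + 1) \<gamma> * vfact d \<gamma>))"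

lemma multi_indices_0: "multi_indices m 0 = {\<lambda>_. 0}"
  by (auto simp: multi_indices_def fun_eq_iff) (metis lessThan_iff not_le)

lemma hahn_E_0: "hahn_E d \<kappa> 0 x y = 1"
  by (simp add: hahn_E_def multi_indices_0 vpochhammer_def vfact_def)

lemma finite_multi_indices: "finite (multi_indices m k)"
proof (rule finite_subset)
  show "multi_indices m k \<subseteq> {\<gamma>. \<forall>i. (i \<in> {..<m} \<longrightarrow> \<gamma> i \<in> {..k}) \<and> (i \<notin> {..<m} \<longrightarrow> \<gamma> i = 0)}"
    by (auto simp: multi_indices_def intro: member_le_sum)
  show "finite {\<gamma>. \<forall>i. (i \<in> {..<m} \<longrightarrow> \<gamma> i \<in> {..k}) \<and> (i \<notin> {..<m} \<longrightarrow> \<gamma> i = (0::nat))}"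
    by (rule finite_set_of_finite_funs) auto
qed

text \<open>Reproducing kernels of finitely spanned function spaces over a finite weighted set.\<close>

definition wip :: "'a set \<Rightarrow> ('a \<Rightarrow> real) \<Rightarrow> ('a \<Rightarrow> real) \<Rightarrow> ('a \<Rightarrow> real) \<Rightarrow> real" where
  "wip S w f g = (\<Sum>a\<in>S. w a * f a * g a)"

lemma wip_diff_left: "wip S w (\<lambda>a. f a - g a) h = wip S w f h - wip S w g h"
  by (simp add: wip_def algebra_simps sum_subtractf)

lemma wip_cong: "(\<And>a. a \<in> S \<Longrightarrow> f a = f' a) \<Longrightarrow> (\<And>a. a \<in> S \<Longrightarrow> g a = g' a)
    \<Longrightarrow> wip S w f g = wip S w f' g'"
  by (simp add: wip_def)

lemma wip_lin_right: "wip S w f (\<lambda>a. c * g a + h a) = c * wip S w f g + wip S w f h"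
  by (simp add: wip_def algebra_simps sum.distrib sum_distrib_left)

lemma wip_lin_left: "wip S w (\<lambda>a. g a * c + h a) f = c * wip S w g f + wip S w h f"
  by (simp add: wip_def algebra_simps sum.distrib sum_distrib_left)

lemma wip_commute: "wip S w f g = wip S w g f"
  by (simp add: wip_def mult_ac)

lemma wip_self_eq_0:
  assumes "finite S" "\<And>a. a \<in> S \<Longrightarrow> w a > 0" "wip S w f f = 0" "a \<in> S"
  shows "f a = 0"
proof -
  have "\<forall>a\<in>S. w a * f a * f a = 0"
    using assms(1,2,3) unfolding wip_def
    by (subst (asm) sum_nonneg_eq_0_iff) (auto simp: mult.assoc less_imp_le)
  thus ?thesis using assms(2,4) by force
qed

definition sspan :: "'a set \<Rightarrow> ('i \<Rightarrow> 'a \<Rightarrow> real) \<Rightarrow> 'i set \<Rightarrow> ('a \<Rightarrow> real) set" where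
  "sspan S b I = {f. \<exists>c. \<forall>a\<in>S. f a = (\<Sum>i\<in>I. c i * b i a)}"

lemma sspan_lin: assumes "f \<in> sspan S b I" "g \<in> sspan S b I"
  shows "(\<lambda>a. u * f a + v * g a) \<in> sspan S b I"
proof -
  obtain c d where "\<forall>a\<in>S. f a = (\<Sum>i\<in>I. c i * b i a)" "\<forall>a\<in>S. g a = (\<Sum>i\<in>I. d i * b i a)"
    using assms by (auto simp: sspan_def)
  hence "\<forall>a\<in>S. u * f a + v * g a = (\<Sum>i\<in>I. (u * c i + v * d i) * b i a)"
    by (simp add: algebra_simps sum.distrib sum_distrib_left)
  thus ?thesis unfolding sspan_def mem_Collect_eq by (rule exI[of _ "\<lambda>i. u * c i + v * d i"])
qed

lemma sspan_sum: assumes "finite T" "\<And>t. t \<in> T \<Longrightarrow> f t \<in> sspan S b I"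
  shows "(\<lambda>a. \<Sum>t\<in>T. u t * f t a) \<in> sspan S b I"
  using assms
proof (induction T rule: finite_induct)
  case empty
  show ?case unfolding sspan_def by (auto intro!: exI[of _ "\<lambda>_. 0"])
next
  case (insert t T)
  show ?case
    using sspan_lin[of "f t" S b I "\<lambda>a. \<Sum>t\<in>T. u t * f t a" "u t" 1] insert by simp
qed

lemma sspan_mono:
  assumes "I \<subseteq> J" "finite J" "f \<in> sspan S b I" shows "f \<in> sspan S b J"
proof -
  obtain c where c: "\<forall>a\<in>S. f a = (\<Sum>i\<in>I. c i * b i a)" using assms by (auto simp: sspan_def)
  have "(\<Sum>i\<in>I. c i * b i a) = (\<Sum>i\<in>J. (if i \<in> I then c i else 0) * b i a)" for a
    by (rule sum.mono_neutral_cong_left) (use assms in auto)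
  thus ?thesis unfolding sspan_def mem_Collect_eq using c
    by (intro exI[of _ "\<lambda>i. if i \<in> I then c i else 0"]) simp
qed

lemma sspan_base: assumes "finite I" "j \<in> I" shows "b j \<in> sspan S b I"
  using assms unfolding sspan_def
  by (auto intro!: exI[of _ "\<lambda>i. if i = j then 1 else 0"] simp: if_distrib[of "\<lambda>x. x * _"] sum.delta cong: if_cong)

lemma sspan_cong: "f \<in> sspan S b I \<Longrightarrow> (\<And>a. a \<in> S \<Longrightarrow> f a = g a) \<Longrightarrow> g \<in> sspan S b I"
  by (auto simp: sspan_def)

lemma ex_span_kernel:
  assumes S: "finite S" and w: "\<And>a. a \<in> S \<Longrightarrow> w a > 0" and "finite I"
  shows "\<exists>K. (\<forall>x y. K x y = K y x) \<and> (\<forall>x. K x \<in> sspan S b I) \<and>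
           (\<forall>Q\<in>sspan S b I. \<forall>x\<in>S. wip S w (K x) Q = Q x)"
  using \<open>finite I\<close>
proof (induction I rule: finite_induct)
  case empty
  show ?case by (rule exI[of _ "\<lambda>_ _. 0"]) (auto simp: sspan_def wip_def)
next
  case (insert j I)
  then obtain K where H: "(\<forall>x y. K x y = K y x) \<and> (\<forall>x. K x \<in> sspan S b I) \<and>
    (\<forall>Q\<in>sspan S b I. \<forall>x\<in>S. wip S w (K x) Q = Q x)" by (elim exE)
  have sym: "K x y = K y x" and K: "K x \<in> sspan S b I" for x y using H by simp_all
  have rep: "wip S w (K x) Q = Q x" if "Q \<in> sspan S b I" "x \<in> S" for Q x using H that by simp
  define p where "p x = wip S w (K x) (b j)" for x
  define g where "g x = b j x - p x" for x
  have p: "p \<in> sspan S b I"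
  proof -
    have "p = (\<lambda>x. \<Sum>a\<in>S. (w a * b j a) * K a x)"
      by (rule ext, simp add: p_def wip_def, subst sym, simp add: mult_ac)
    moreover have "(\<lambda>x. \<Sum>a\<in>S. (w a * b j a) * K a x) \<in> sspan S b I"
      by (rule sspan_sum[OF S K])
    ultimately show ?thesis by metis
  qed
  have orth: "wip S w g Q = 0" if Q: "Q \<in> sspan S b I" for Q
  proof -
    have "wip S w p Q = (\<Sum>a\<in>S. \<Sum>c\<in>S. w a * (w c * K a c * b j c) * Q a)"
      by (simp add: wip_def p_def sum_distrib_left sum_distrib_right)
    also have "\<dots> = (\<Sum>c\<in>S. \<Sum>a\<in>S. w a * (w c * K a c * b j c) * Q a)" by (rule sum.swap)
    also have "\<dots> = (\<Sum>c\<in>S. w c * b j c * wip S w (K c) Q)"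
      unfolding wip_def sum_distrib_left by (intro sum.cong refl, subst sym) (simp add: mult_ac)
    also have "\<dots> = (\<Sum>c\<in>S. w c * b j c * Q c)" by (intro sum.cong refl) (simp add: rep[OF Q])
    also have "\<dots> = wip S w (b j) Q" by (simp add: wip_def)
    finally show ?thesis by (simp add: g_def[abs_def] wip_diff_left)
  qed
  have fin: "finite (insert j I)" using insert by simp
  note mono = sspan_mono[OF subset_insertI fin]
  have g: "g \<in> sspan S b (insert j I)"
    using sspan_lin[OF sspan_base[OF fin insertI1] mono[OF p], of 1 "-1"]
    by (simp add: g_def[abs_def])
  define K' where "K' x y = g x * g y / wip S w g g + K x y" for x y
  have "wip S w (K' x) Q = Q x" if Q: "Q \<in> sspan S b (insert j I)" and x: "x \<in> S" for Q x
  proof -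
    obtain c where c: "\<forall>a\<in>S. Q a = (\<Sum>i\<in>insert j I. c i * b i a)" using Q by (auto simp: sspan_def)
    define R where "R a = c j * p a + 1 * (\<Sum>i\<in>I. c i * b i a)" for a
    have R: "R \<in> sspan S b I" unfolding R_def[abs_def]
      by (rule sspan_lin[OF p]) (auto simp: sspan_def)
    have QR: "\<And>a. a \<in> S \<Longrightarrow> Q a = c j * g a + R a"
      using c insert.hyps by (simp add: R_def g_def algebra_simps)
    have QR': "wip S w h Q = wip S w h (\<lambda>a. c j * g a + R a)" for h
      by (rule wip_cong) (simp_all add: QR)
    have 1: "wip S w g Q = c j * wip S w g g"
      using orth[OF R] by (simp add: QR' wip_lin_right)
    have "wip S w (K x) g = 0" using orth[OF K] by (subst wip_commute)
    hence 2: "wip S w (K x) Q = R x"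
      using rep[OF R x] by (simp add: QR' wip_lin_right)
    have 3: "wip S w g g = 0 \<Longrightarrow> g x = 0" using wip_self_eq_0[where w = w, OF S w _ x] by simp
    have "wip S w (K' x) Q = g x / wip S w g g * wip S w g Q + wip S w (K x) Q"
      using wip_lin_left[of S w g "g x / wip S w g g" "K x" Q] by (simp add: K'_def[abs_def] mult_ac)
    also have "\<dots> = Q x" using 3 QR[OF x] unfolding 1 2 by (cases "wip S w g g = 0") auto
    finally show ?thesis .
  qed
  moreover have "K' x \<in> sspan S b (insert j I)" for x
    using sspan_lin[OF g mono[OF K[of x]], of "g x / wip S w g g" 1]
    by (simp add: K'_def[abs_def])
  moreover have "K' x y = K' y x" for x y using sym by (simp add: K'_def mult_ac)
  ultimately show ?case by (intro exI[of _ K'] conjI allI ballI)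
qed

text \<open>The description defining \<^const>\<open>hahn_kernel\<close> is satisfied by exactly one function.\<close>

lemma ex1_hahn_kernel:
  assumes \<kappa>: "\<forall>i\<le>d. \<kappa> i > -1"
  shows "\<exists>!K. is_hahn_kernel d \<kappa> N n K \<and>
           (\<forall>x y. x \<notin> hahn_grid d N \<or> y \<notin> hahn_grid d N \<longrightarrow> K x y = 0)"
proof -
  define S where "S = hahn_grid d N"
  define w where "w \<alpha> = fact N / pochhammer (vsum d \<kappa> + real d + 1) N *
    (vpochhammer d (\<lambda>i. \<kappa> i + 1) \<alpha> / vfact d \<alpha>)" for \<alpha>
  define mon where "mon \<gamma> \<alpha> = (\<Prod>i<d. real (\<alpha> i) ^ \<gamma> i)" for \<gamma> \<alpha> :: "nat \<Rightarrow> nat"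
  define I where "I n = (\<Union>k\<le>n. multi_indices d k)" for n
  have S: "finite S" by (simp add: S_def finite_multi_indices)
  have I: "finite (I m)" for m by (auto simp: I_def finite_multi_indices)
  have Im: "I m \<subseteq> I m'" if "m \<le> m'" for m m' using that by (force simp: I_def)
  have "(\<Sum>i<d + 1. - 1) < vsum d \<kappa>"
    unfolding vsum_def by (rule sum_strict_mono) (use \<kappa> in auto)
  hence "vsum d \<kappa> + real d + 1 > 0" by simp
  moreover have "0 < \<kappa> i + 1" if "i < d + 1" for i using \<kappa>[rule_format, of i] that by simp
  ultimately have w: "w a > 0" for a unfolding w_def vpochhammer_def vfact_def
    by (intro mult_pos_pos divide_pos_pos prod_pos pochhammer_pos) auto
  have ip: "hahn_inner d \<kappa> N f g = wip S w f g" for f g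
    by (simp add: hahn_inner_def wip_def S_def w_def sum_distrib_left mult_ac)
  have gp: "grid_polys d N m = sspan S mon (I m)" for m
    by (simp add: grid_polys_def sspan_def S_def mon_def I_def)
  define J where "J = (if n = 0 then {} else I (n - 1))"
  have J: "finite J" "J \<subseteq> I n" using I Im by (auto simp: J_def)
  have low: "f \<in> sspan S mon J" if "m < n" "f \<in> sspan S mon (I m)" for f m
proof -
    have "m \<le> n - 1" using that by simp
    from sspan_mono[OF Im[OF this] I that(2)] show ?thesis using that by (simp add: J_def)
  qed
  have hs: "hahn_space d \<kappa> N n = {f \<in> sspan S mon (I n). \<forall>g\<in>sspan S mon J. wip S w f g = 0}"
  proof -
    have "(\<forall>m<n. \<forall>g\<in>sspan S mon (I m). wip S w f g = 0) \<longleftrightarrow> (\<forall>g\<in>sspan S mon J. wip S w f g = 0)" for f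
    proof
      assume L: "\<forall>m<n. \<forall>g\<in>sspan S mon (I m). wip S w f g = 0"
      show "\<forall>g\<in>sspan S mon J. wip S w f g = 0"
      proof (cases "n = 0")
        case True
        thus ?thesis by (auto simp: J_def sspan_def wip_def)
      next
        case False
        thus ?thesis using L[rule_format, of "n - 1"] by (auto simp: J_def)
      qed
    qed (use low in blast)
    thus ?thesis by (simp add: hahn_space_def gp ip)
  qed
  obtain K1 where K1: "(\<forall>x y. K1 x y = K1 y x) \<and> (\<forall>x. K1 x \<in> sspan S mon (I n)) \<and>
    (\<forall>Q\<in>sspan S mon (I n). \<forall>x\<in>S. wip S w (K1 x) Q = Q x)"
    using ex_span_kernel[where b = mon and w = w, OF S w I[of n]] by (elim exE)
  have 1: "K1 x y = K1 y x" "K1 x \<in> sspan S mon (I n)"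
    "Q \<in> sspan S mon (I n) \<Longrightarrow> x \<in> S \<Longrightarrow> wip S w (K1 x) Q = Q x" for x y Q
    using K1 by simp_all
  obtain K2 where K2: "(\<forall>x y. K2 x y = K2 y x) \<and> (\<forall>x. K2 x \<in> sspan S mon J) \<and>
    (\<forall>Q\<in>sspan S mon J. \<forall>x\<in>S. wip S w (K2 x) Q = Q x)"
    using ex_span_kernel[where b = mon and w = w, OF S w J(1)] by (elim exE)
  have 2: "K2 x y = K2 y x" "K2 x \<in> sspan S mon J"
    "Q \<in> sspan S mon J \<Longrightarrow> x \<in> S \<Longrightarrow> wip S w (K2 x) Q = Q x" for x y Q
    using K2 by simp_all
  define K where "K x y = (if x \<in> S \<and> y \<in> S then K1 x y - K2 x y else 0)" for x y
  have K0: "x \<notin> S \<or> y \<notin> S \<Longrightarrow> K x y = 0" for x y by (auto simp: K_def)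
  have Kip: "wip S w (K x) Q = wip S w (K1 x) Q - wip S w (K2 x) Q" if "x \<in> S" for x Q
    using that by (simp add: wip_diff_left[symmetric], intro wip_cong) (auto simp: K_def)
  have Kin: "K x \<in> hahn_space d \<kappa> N n" if x: "x \<in> S" for x
  proof -
    have "K x \<in> sspan S mon (I n)"
      by (rule sspan_cong[OF sspan_lin[OF 1(2)[of x] sspan_mono[OF J(2) I 2(2)[of x]], of 1 "-1"]])
         (use x in \<open>auto simp: K_def\<close>)
    moreover have "wip S w (K x) g = 0" if "g \<in> sspan S mon J" for g
      using Kip[OF x] 1(3)[OF sspan_mono[OF J(2) I that] x] 2(3)[OF that x] by simp
    ultimately show ?thesis by (simp add: hs)
  qed
  have Ksym: "K x y = K y x" for x y using 1(1) 2(1) by (simp add: K_def)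
  have Krep: "wip S w (K x) Q = Q x" if "x \<in> S" "Q \<in> hahn_space d \<kappa> N n" for x Q
  proof -
    have "wip S w (K1 x) Q = Q x" using 1(3)[OF _ that(1)] that(2) by (simp add: hs)
    moreover have "wip S w (K2 x) Q = 0"
      using that(2) 2(2)[of x] by (subst wip_commute) (simp add: hs)
    ultimately show ?thesis by (simp add: Kip[OF that(1)])
  qed
  show ?thesis
  proof (rule ex1I[of _ K])
    have "(\<lambda>x. K x y) \<in> hahn_space d \<kappa> N n" if "y \<in> S" for y
      using Kin[OF that] by (subst Ksym)
    thus "is_hahn_kernel d \<kappa> N n K \<and>
        (\<forall>x y. x \<notin> hahn_grid d N \<or> y \<notin> hahn_grid d N \<longrightarrow> K x y = 0)"
      using Kin Krep K0 unfolding is_hahn_kernel_def ip S_def[symmetric] by blast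
  next
    fix L
    assume L: "is_hahn_kernel d \<kappa> N n L \<and>
        (\<forall>x y. x \<notin> hahn_grid d N \<or> y \<notin> hahn_grid d N \<longrightarrow> L x y = 0)"
    show "L = K"
    proof (intro ext)
      fix x y
      show "L x y = K x y"
      proof (cases "x \<in> S \<and> y \<in> S")
        case True
        define D where "D a = L x a - K x a" for a
        have Lx: "L x \<in> hahn_space d \<kappa> N n"
          and Lrep: "\<And>Q. Q \<in> hahn_space d \<kappa> N n \<Longrightarrow> wip S w (L x) Q = Q x"
          using L True unfolding is_hahn_kernel_def S_def[symmetric] ip by blast+
        have "D \<in> hahn_space d \<kappa> N n"
          using Lx Kin[of x] True sspan_lin[of "L x" S mon "I n" "K x" 1 "-1"]
          by (auto simp: hs D_def[abs_def] wip_diff_left)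
        hence "wip S w D D = 0"
          using Lrep Krep True by (simp add: D_def[abs_def] wip_diff_left)
        hence "D y = 0" using wip_self_eq_0[where w = w, OF S w] True by simp
        thus ?thesis by (simp add: D_def)
      next
        case False
        thus ?thesis using L K0 unfolding S_def[symmetric] by metis
      qed
    qed
  qed
qed

end

(*
  Let A = |kappa| + d + 1 and let K be the claimed right-hand side. Besides the polynomials
  (-x)_gamma that make up the functions E_k, use the polynomials (kappa + 1 + x)_delta, which pair
  with them in closed form: (kappa + 1)_alpha (kappa + 1 + alpha)_delta = (kappa + 1)_(alpha + delta),
  so the multivariate Chu-Vandermonde identity evaluates the sum over the grid. Expanding
  (kappa + 1 + x)_delta = sum of c(eps) (-x)_eps and applying the identity once more to the sum over
  gamma in E_k gives, for |delta| = m <= n,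
    <K(x, .), (kappa + 1 + .)_delta> = sum of c(eps) lambda(n, m, |eps|) (-x)_eps,
  where lambda is a univariate Chu-Vandermonde sum. It vanishes for m < n, so that K(x, .) is
  orthogonal to all polynomials of degree below n, and lambda(n, n, n) = 1. Hence for Q in V_n the
  function <K(x, .), Q> - Q(x) has degree less than n and also lies in V_n, so it is zero.
*)

theory Submission
  imports Defs "HOL-Computational_Algebra.Formal_Power_Series"
begin

section \<open>Sums over multi-indices and the multivariate Chu-Vandermonde identity\<close>

lemma sum_multi_indices_Suc:
  "(\<Sum>\<gamma>\<in>multi_indices (Suc m) k. f \<gamma>) =
     (\<Sum>j\<le>k. \<Sum>\<beta>\<in>multi_indices m (k - j). f (\<beta>(m := j)))"
proof -
  have "(\<Sum>j\<le>k. \<Sum>\<beta>\<in>multi_indices m (k - j). f (\<beta>(m := j))) =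
      (\<Sum>(j, \<beta>)\<in>(SIGMA j:{..k}. multi_indices m (k - j)). f (\<beta>(m := j)))"
    by (rule sum.Sigma) (auto simp: finite_multi_indices)
  also have "\<dots> = (\<Sum>\<gamma>\<in>multi_indices (Suc m) k. f \<gamma>)"
    \<comment> \<open>The inverse map resets component \<open>m\<close> to 0, since members of
      \<open>multi_indices m\<close> vanish from \<open>m\<close> on.\<close>
    by (rule sum.reindex_bij_witness[where i = "\<lambda>\<gamma>. (\<gamma> m, \<gamma>(m := 0))" and j = "\<lambda>(j, \<beta>). \<beta>(m := j)"])
      (auto simp: multi_indices_def fun_eq_iff split: if_splits)
  finally show ?thesis by simp
qed

text \<open>Both sides are the coefficient of t^k in the product of the series (1 - t)^(-a_i). The
  induction splits off the last component; each step is the univariate identity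
  \<open>pochhammer_binomial_sum\<close>.\<close>

lemma multi_Vandermonde_pochhammer:
  fixes a :: "nat \<Rightarrow> real"
  shows "(\<Sum>\<gamma>\<in>multi_indices m k. \<Prod>i<m. pochhammer (a i) (\<gamma> i) / fact (\<gamma> i)) =
    pochhammer (\<Sum>i<m. a i) k / fact k"
proof (induction m arbitrary: k)
  case 0
  show ?case
  proof (cases k)
    case 0
    then show ?thesis by (simp add: multi_indices_0)
  next
    case (Suc k')
    \<comment> \<open>The empty sum matches the right-hand side because a Pochhammer symbol at 0
      vanishes in positive degree.\<close>
    then have "multi_indices 0 k = {}" by (auto simp: multi_indices_def)
    then show ?thesis using Suc by (simp add: pochhammer_0_left)
  qed
next
  case (Suc m)
  have "(\<Sum>\<gamma>\<in>multi_indices (Suc m) k. \<Prod>i<Suc m. pochhammer (a i) (\<gamma> i) / fact (\<gamma> i)) =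
      (\<Sum>j\<le>k. \<Sum>\<beta>\<in>multi_indices m (k - j).
        (\<Prod>i<m. pochhammer (a i) (\<beta> i) / fact (\<beta> i)) * (pochhammer (a m) j / fact j))"
    by (simp add: sum_multi_indices_Suc)
  also have "\<dots> = (\<Sum>j\<le>k. pochhammer (\<Sum>i<m. a i) (k - j) / fact (k - j) * (pochhammer (a m) j / fact j))"
    by (simp only: Suc.IH flip: sum_distrib_right)
  also have "\<dots> = (\<Sum>j\<le>k. of_nat (k choose j) * pochhammer (a m) j * pochhammer (\<Sum>i<m. a i) (k - j)) / fact k"
    unfolding sum_divide_distrib by (intro sum.cong refl) (simp add: binomial_fact mult_ac)
  also have "\<dots> = pochhammer (\<Sum>i<Suc m. a i) k / fact k"
    by (simp flip: pochhammer_binomial_sum add: add.commute)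
  finally show ?case .
qed

text \<open>Supports induction on the degree, in the shape required by recurrences that raise one
  component of the index.\<close>

lemma multi_indices_Suc_cases:
  assumes "\<gamma> \<in> multi_indices m (Suc k)"
  obtains \<beta> i where "\<beta> \<in> multi_indices m k" "i < m" "\<gamma> = \<beta>(i := Suc (\<beta> i))"
proof -
  have "(\<Sum>i<m. \<gamma> i) \<noteq> 0"
    using assms by (simp add: multi_indices_def)
  then obtain i where i: "i < m" "\<gamma> i \<noteq> 0"
    by (meson lessThan_iff sum.not_neutral_contains_not_neutral)
  have "(\<Sum>l<m. \<gamma> l) = \<gamma> i + (\<Sum>l\<in>{..<m} - {i}. \<gamma> l)"
    using i by (intro sum.remove) auto
  moreover have "(\<Sum>l<m. (\<gamma>(i := \<gamma> i - 1)) l) = (\<gamma> i - 1) + (\<Sum>l\<in>{..<m} - {i}. \<gamma> l)"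
    using i by (subst sum.remove[of _ i]) auto
  ultimately have "\<gamma>(i := \<gamma> i - 1) \<in> multi_indices m k"
    using assms i by (auto simp: multi_indices_def)
  with i show thesis by (intro that[of "\<gamma>(i := \<gamma> i - 1)" i]) auto
qed

lemma multi_indices_SucI:
  assumes "\<beta> \<in> multi_indices m k" "i < m"
  shows "\<beta>(i := Suc (\<beta> i)) \<in> multi_indices m (Suc k)"
proof -
  have "(\<Sum>l<m. \<beta> l) = \<beta> i + (\<Sum>l\<in>{..<m} - {i}. \<beta> l)"
    using assms by (intro sum.remove) auto
  moreover have "(\<Sum>l<m. (\<beta>(i := Suc (\<beta> i))) l) = Suc (\<beta> i) + (\<Sum>l\<in>{..<m} - {i}. \<beta> l)"
    using assms by (subst sum.remove[of _ i]) auto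
  ultimately show ?thesis using assms by (auto simp: multi_indices_def)
qed

lemma vpochhammer_add:
  "vpochhammer d a (\<lambda>i. \<beta> i + \<gamma> i) = vpochhammer d a \<beta> * vpochhammer d (\<lambda>i. a i + real (\<beta> i)) \<gamma>"
  by (simp add: vpochhammer_def pochhammer_product' flip: prod.distrib)

lemma vpochhammer_upd_Suc:
  assumes "i < d + 1"
  shows "vpochhammer d a (\<gamma>(i := Suc (\<gamma> i))) = (a i + real (\<gamma> i)) * vpochhammer d a \<gamma>"
proof -
  have "vpochhammer d a \<beta> = pochhammer (a i) (\<beta> i) * (\<Prod>l\<in>{..<d+1} - {i}. pochhammer (a l) (\<beta> l))" for \<beta>
    unfolding vpochhammer_def by (rule prod.remove) (use assms in auto)
  then show ?thesis by (simp add: pochhammer_Suc mult_ac)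
qed

lemma monomial_upd_Suc:
  fixes \<alpha> \<gamma> :: "nat \<Rightarrow> nat"
  assumes "i < d"
  shows "(\<Prod>l<d. real (\<alpha> l) ^ (\<gamma>(i := Suc (\<gamma> i))) l) = real (\<alpha> i) * (\<Prod>l<d. real (\<alpha> l) ^ \<gamma> l)"
proof -
  have "(\<Prod>l<d. real (\<alpha> l) ^ \<beta> l) = real (\<alpha> i) ^ \<beta> i * (\<Prod>l\<in>{..<d} - {i}. real (\<alpha> l) ^ \<beta> l)" for \<beta>
    by (rule prod.remove) (use assms in auto)
  then show ?thesis by simp
qed

lemma vfact_pos: "vfact d \<gamma> > 0"
  unfolding vfact_def by (rule prod_pos) simp

lemma vpochhammer_pos: "(\<And>i. i < d + 1 \<Longrightarrow> a i > 0) \<Longrightarrow> vpochhammer d a \<gamma> > 0"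
  unfolding vpochhammer_def by (intro prod_pos ballI pochhammer_pos) simp

text \<open>This is (-x)_e = (-1)^e x! / (x - e)!, with x written as b + e to avoid truncated
  subtraction.\<close>

lemma pochhammer_minus_of_nat_eq: 
  "pochhammer (- real (b + e)) e = (- 1) ^ e * fact (b + e) / fact b"
proof -
  have "fact (b + e) = fact b * pochhammer (1 + real b) e"
    by (simp add: pochhammer_fact pochhammer_product')
  then show ?thesis
    using pochhammer_minus[of "real (b + e)" e] by (simp add: add_ac)
qed

text \<open>The terms where \<open>\<epsilon> \<le> \<gamma>\<close> fails are zero; the others are reindexed by \<open>\<gamma> - \<epsilon>\<close>.\<close>

lemma sum_vpochhammer_mult:
  fixes a :: "nat \<Rightarrow> real"
  assumes \<epsilon>: "\<epsilon> \<in> multi_indices (d + 1) j" and \<delta>: "\<delta> \<in> multi_indices (d + 1) l"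
  shows "(\<Sum>\<gamma>\<in>multi_indices (d + 1) k. vpochhammer d a \<gamma> / vfact d \<gamma> *
      vpochhammer d (\<lambda>i. - real (\<gamma> i)) \<epsilon> * vpochhammer d (\<lambda>i. a i + real (\<gamma> i)) \<delta>) =
    (if j \<le> k then (-1) ^ j * vpochhammer d a (\<lambda>i. \<epsilon> i + \<delta> i) *
        pochhammer ((\<Sum>i<d + 1. a i) + real (j + l)) (k - j) / fact (k - j) else 0)"
    (is "(\<Sum>\<gamma>\<in>_. ?f \<gamma>) = ?rhs")
proof -
  define T where "T = {\<gamma> \<in> multi_indices (d + 1) k. \<forall>i. \<epsilon> i \<le> \<gamma> i}"
  have zero: "?f \<gamma> = 0" if "\<gamma> \<in> multi_indices (d + 1) k - T" for \<gamma>
  proof -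
    obtain i where i: "\<gamma> i < \<epsilon> i" using \<open>\<gamma> \<in> _\<close> by (auto simp: T_def not_le)
    have "i < d + 1"
      using i \<epsilon> by (cases "i < d + 1") (auto simp: multi_indices_def)
    \<comment> \<open>The factors run from -\<gamma>_i up to \<epsilon>_i - \<gamma>_i - 1, and this
      range includes 0.\<close>
    moreover have "pochhammer (- real (\<gamma> i)) (\<epsilon> i) = 0"
      using i by (simp add: pochhammer_of_nat_eq_0_iff)
    ultimately have "vpochhammer d (\<lambda>i. - real (\<gamma> i)) \<epsilon> = 0"
      unfolding vpochhammer_def by (intro prod_zero bexI[of _ i]) auto
    then show ?thesis by simp
  qed
  have "(\<Sum>\<gamma>\<in>multi_indices (d + 1) k. ?f \<gamma>) = (\<Sum>\<gamma>\<in>T. ?f \<gamma>)"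
    by (rule sum.mono_neutral_right) (use zero in \<open>auto simp: T_def finite_multi_indices\<close>)
  also have "\<dots> = ?rhs"
  proof (cases "j \<le> k")
    case False
    have "j \<le> k" if "\<gamma> \<in> T" for \<gamma>
    proof -
      have "(\<Sum>i<d + 1. \<epsilon> i) \<le> (\<Sum>i<d + 1. \<gamma> i)"
        by (rule sum_mono) (use that in \<open>auto simp: T_def\<close>)
      then show ?thesis using that \<epsilon> by (simp add: T_def multi_indices_def)
    qed
    then have "T = {}" using False by auto
    then show ?thesis using False by simp
  next
    case True
    have "(\<lambda>i. \<gamma> i - \<epsilon> i) \<in> multi_indices (d + 1) (k - j)" if "\<gamma> \<in> T" for \<gamma>
    proof -
      have "(\<Sum>i<d + 1. \<gamma> i) = (\<Sum>i<d + 1. (\<gamma> i - \<epsilon> i) + \<epsilon> i)"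
        by (rule sum.cong) (use that in \<open>auto simp: T_def\<close>)
      then show ?thesis using that \<epsilon> by (simp only: sum.distrib) (auto simp: T_def multi_indices_def simp del: sum.lessThan_Suc)
    qed
    moreover have "(\<lambda>i. \<beta> i + \<epsilon> i) \<in> T" if "\<beta> \<in> multi_indices (d + 1) (k - j)" for \<beta>
      using that \<epsilon> True by (simp add: T_def multi_indices_def sum.distrib del: sum.lessThan_Suc)
    ultimately have "(\<Sum>\<gamma>\<in>T. ?f \<gamma>) = (\<Sum>\<beta>\<in>multi_indices (d + 1) (k - j). ?f (\<lambda>i. \<beta> i + \<epsilon> i))"
      by (intro sum.reindex_bij_witness[where j = "\<lambda>\<gamma> i. \<gamma> i - \<epsilon> i" and i = "\<lambda>\<beta> i. \<beta> i + \<epsilon> i"])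
        (auto simp: T_def)
    also have "\<dots> = (\<Sum>\<beta>\<in>multi_indices (d + 1) (k - j). (-1) ^ j * vpochhammer d a (\<lambda>i. \<epsilon> i + \<delta> i) *
        (\<Prod>i<d + 1. pochhammer (a i + real (\<epsilon> i + \<delta> i)) (\<beta> i) / fact (\<beta> i)))"
    proof (rule sum.cong[OF refl])
      fix \<beta> assume "\<beta> \<in> multi_indices (d + 1) (k - j)"
      \<comment> \<open>The two symbols merge into one of degree \<beta> + \<epsilon> + \<delta>,
        which is split again with \<epsilon> + \<delta> first, so that the first factor is
        independent of the summation index \<beta>.\<close>
      have "vpochhammer d a (\<lambda>i. \<beta> i + \<epsilon> i) * vpochhammer d (\<lambda>i. a i + real (\<beta> i + \<epsilon> i)) \<delta>
          = vpochhammer d a (\<lambda>i. \<epsilon> i + \<delta> i + \<beta> i)"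
        by (subst vpochhammer_add[symmetric]) (simp add: add_ac)
      also have "\<dots> = vpochhammer d a (\<lambda>i. \<epsilon> i + \<delta> i) * (\<Prod>i<d + 1. pochhammer (a i + real (\<epsilon> i + \<delta> i)) (\<beta> i))"
        by (subst vpochhammer_add) (simp add: vpochhammer_def)
      finally have 1: "vpochhammer d a (\<lambda>i. \<beta> i + \<epsilon> i) * vpochhammer d (\<lambda>i. a i + real (\<beta> i + \<epsilon> i)) \<delta> = \<dots>" .
      \<comment> \<open>Each factor of the symbol in 2 is a sign times (\<beta>_i + \<epsilon>_i)! /
        \<beta>_i!. Its numerator cancels the factorial of the shifted index and leaves
        1/\<beta>_i!.\<close>
      have "(\<Prod>i<d + 1. (- 1 :: real) ^ \<epsilon> i) = (-1) ^ j"
        using \<epsilon> by (simp add: multi_indices_def flip: power_sum)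
      then have 2: "vpochhammer d (\<lambda>i. - real (\<beta> i + \<epsilon> i)) \<epsilon> = (-1) ^ j * vfact d (\<lambda>i. \<beta> i + \<epsilon> i) / vfact d \<beta>"
        unfolding vpochhammer_def pochhammer_minus_of_nat_eq vfact_def
        by (simp only: prod_dividef prod.distrib)
      have "?f (\<lambda>i. \<beta> i + \<epsilon> i) =
          vpochhammer d a (\<lambda>i. \<beta> i + \<epsilon> i) * vpochhammer d (\<lambda>i. a i + real (\<beta> i + \<epsilon> i)) \<delta> *
          (vpochhammer d (\<lambda>i. - real (\<beta> i + \<epsilon> i)) \<epsilon> / vfact d (\<lambda>i. \<beta> i + \<epsilon> i))"
        by simp
      also have "\<dots> = (-1) ^ j * vpochhammer d a (\<lambda>i. \<epsilon> i + \<delta> i) *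
          ((\<Prod>i<d + 1. pochhammer (a i + real (\<epsilon> i + \<delta> i)) (\<beta> i)) / vfact d \<beta>)"
        unfolding 1 2 using vfact_pos[of d "\<lambda>i. \<beta> i + \<epsilon> i"] by simp
      also have "\<dots> = (-1) ^ j * vpochhammer d a (\<lambda>i. \<epsilon> i + \<delta> i) *
        (\<Prod>i<d + 1. pochhammer (a i + real (\<epsilon> i + \<delta> i)) (\<beta> i) / fact (\<beta> i))"
        by (simp only: vfact_def prod_dividef)
      finally show "?f (\<lambda>i. \<beta> i + \<epsilon> i) = \<dots>" .
    qed
    also have "\<dots> = ?rhs"
    proof -
      \<comment> \<open>The remaining sum over \<beta> is a multivariate Chu-Vandermonde sum with
        shifted parameters; the shifts add up to the degrees of \<epsilon> and \<delta>.\<close>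
      have "(\<Sum>i<d + 1. a i + real (\<epsilon> i + \<delta> i)) = (\<Sum>i<d + 1. a i) + real (j + l)"
        using \<epsilon> \<delta> by (simp add: multi_indices_def sum.distrib flip: of_nat_sum)
      then show ?thesis
        by (simp only: multi_Vandermonde_pochhammer True if_True flip: sum_distrib_left) simp
    qed
    finally show ?thesis .
  qed
  finally show ?thesis .
qed


section \<open>Changes of basis between monomials, falling and rising products\<close>

definition upto_indices :: "nat \<Rightarrow> nat \<Rightarrow> (nat \<Rightarrow> nat) set" where
  "upto_indices D m = (\<Union>k\<le>m. multi_indices D k)"

lemma upto_indices_iff: "\<gamma> \<in> upto_indices D m \<longleftrightarrow> (\<exists>k\<le>m. \<gamma> \<in> multi_indices D k)"
  by (auto simp: upto_indices_def)

lemma finite_upto_indices: "finite (upto_indices D m)"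
  by (simp add: upto_indices_def finite_multi_indices)

lemma upto_indices_0: "upto_indices D 0 = {\<lambda>_. 0}"
  by (simp add: upto_indices_def multi_indices_0)

lemma upto_indices_mono: "k \<le> m \<Longrightarrow> upto_indices D k \<subseteq> upto_indices D m"
  unfolding upto_indices_def by (intro UN_mono) auto

lemma sspan_upto_mono:
  "f \<in> sspan S b (upto_indices D k) \<Longrightarrow> k \<le> m \<Longrightarrow> f \<in> sspan S b (upto_indices D m)"
  by (rule sspan_mono[OF upto_indices_mono finite_upto_indices])

text \<open>The hypothesis \<open>step\<close> can be solved for the product of a coordinate with
  \<open>b \<gamma>\<close>, which costs one degree. Keeping \<open>b\<close> abstract treats
  monomials, falling and rising products at once.\<close>

lemma sspan_mult_affine:
  fixes b :: "(nat \<Rightarrow> nat) \<Rightarrow> (nat \<Rightarrow> nat) \<Rightarrow> real"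
  assumes step: "\<And>\<gamma> i \<alpha>. i < D \<Longrightarrow>
      b (\<gamma>(i := Suc (\<gamma> i))) \<alpha> = (s * real (\<alpha> i) + t \<gamma> i) * b \<gamma> \<alpha>"
    and s: "s \<noteq> 0" and f: "f \<in> sspan S b (upto_indices D m)" and i: "i < D"
  shows "(\<lambda>\<alpha>. (u * real (\<alpha> i) + v) * f \<alpha>) \<in> sspan S b (upto_indices D (Suc m))"
proof -
  obtain c where c: "\<And>\<alpha>. \<alpha> \<in> S \<Longrightarrow> f \<alpha> = (\<Sum>\<gamma>\<in>upto_indices D m. c \<gamma> * b \<gamma> \<alpha>)"
    using f by (auto simp: sspan_def)
  have mult: "(\<lambda>\<alpha>. (u * real (\<alpha> i) + v) * b \<gamma> \<alpha>) \<in> sspan S b (upto_indices D (Suc m))"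
    if \<gamma>: "\<gamma> \<in> upto_indices D m" for \<gamma>
  proof -
    have "\<gamma>(i := Suc (\<gamma> i)) \<in> upto_indices D (Suc m)"
      using \<gamma> multi_indices_SucI[OF _ i] by (auto simp: upto_indices_iff intro: Suc_le_mono[THEN iffD2])
    moreover have "\<gamma> \<in> upto_indices D (Suc m)"
      using \<gamma> upto_indices_mono[of m "Suc m" D] by auto
    \<comment> \<open>These coefficients come from writing u times the coordinate plus v as u/s
      times the affine factor in \<open>step\<close>, plus a constant.\<close>
    ultimately have "(\<lambda>\<alpha>. u / s * b (\<gamma>(i := Suc (\<gamma> i))) \<alpha> + (v - u * t \<gamma> i / s) * b \<gamma> \<alpha>)
        \<in> sspan S b (upto_indices D (Suc m))"
      by (intro sspan_lin sspan_base finite_upto_indices)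
    then show ?thesis
      by (rule sspan_cong) (use s in \<open>simp add: step[OF i] field_simps\<close>)
  qed
  have "(\<lambda>\<alpha>. \<Sum>\<gamma>\<in>upto_indices D m. c \<gamma> * ((u * real (\<alpha> i) + v) * b \<gamma> \<alpha>))
      \<in> sspan S b (upto_indices D (Suc m))"
    by (rule sspan_sum) (use mult finite_upto_indices in auto)
  then show ?thesis
    by (rule sspan_cong) (simp add: c sum_distrib_left mult_ac)
qed

text \<open>Raising one component of the index multiplies \<open>h\<close> by an affine function,
  which \<open>cl\<close> permits at the cost of one degree. With \<open>P\<close> the spans of
  another family this yields a degree-preserving change of basis.\<close>

lemma graded_family_mem:
  assumes "h (\<lambda>_. 0) \<in> P 0"
    and step: "\<And>\<gamma> i \<alpha>. i < D \<Longrightarrow>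
      h (\<gamma>(i := Suc (\<gamma> i))) \<alpha> = (u * real (\<alpha> i) + v \<gamma> i) * h \<gamma> \<alpha>"
    and cl: "\<And>m f i c. i < D \<Longrightarrow> f \<in> P m \<Longrightarrow> (\<lambda>\<alpha>. (u * real (\<alpha> i) + c) * f \<alpha>) \<in> P (Suc m)"
    and "\<gamma> \<in> multi_indices D k"
  shows "h \<gamma> \<in> P k"
  using assms(4)
proof (induction k arbitrary: \<gamma>)
  case 0
  then show ?case using assms(1) by (simp add: multi_indices_0)
next
  case (Suc k)
  obtain \<beta> i where \<beta>: "\<beta> \<in> multi_indices D k" "i < D" "\<gamma> = \<beta>(i := Suc (\<beta> i))"
    using Suc.prems by (rule multi_indices_Suc_cases)
  have "h \<gamma> = (\<lambda>\<alpha>. (u * real (\<alpha> i) + v \<beta> i) * h \<beta> \<alpha>)"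
    using \<beta> step by auto
  then show ?case using cl[OF \<beta>(2) Suc.IH[OF \<beta>(1)]] by metis
qed

definition monomial :: "nat \<Rightarrow> (nat \<Rightarrow> nat) \<Rightarrow> (nat \<Rightarrow> nat) \<Rightarrow> real" where
  "monomial d \<gamma> \<alpha> = (\<Prod>i<d. real (\<alpha> i) ^ \<gamma> i)"

text \<open>Up to the sign \<open>(-1)\<^sup>k\<close>, \<open>k\<close> the degree, this is a product of falling factorials.\<close>

definition falling :: "nat \<Rightarrow> (nat \<Rightarrow> nat) \<Rightarrow> (nat \<Rightarrow> nat) \<Rightarrow> real" where
  "falling d \<gamma> \<alpha> = vpochhammer d (\<lambda>i. - real (\<alpha> i)) \<gamma>"

definition rising :: "nat \<Rightarrow> (nat \<Rightarrow> real) \<Rightarrow> (nat \<Rightarrow> nat) \<Rightarrow> (nat \<Rightarrow> nat) \<Rightarrow> real" where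
  "rising d \<kappa> \<gamma> \<alpha> = vpochhammer d (\<lambda>i. \<kappa> i + 1 + real (\<alpha> i)) \<gamma>"

lemma grid_polys_eq: "grid_polys d N m = sspan (hahn_grid d N) (monomial d) (upto_indices d m)"
  by (simp add: grid_polys_def sspan_def monomial_def upto_indices_def)

lemma monomial_step:
  "i < d \<Longrightarrow> monomial d (\<gamma>(i := Suc (\<gamma> i))) \<alpha> = (1 * real (\<alpha> i) + 0) * monomial d \<gamma> \<alpha>"
  unfolding monomial_def by (subst monomial_upd_Suc) auto

lemma falling_step:
  "i < d + 1 \<Longrightarrow> falling d (\<gamma>(i := Suc (\<gamma> i))) \<alpha> = (-1 * real (\<alpha> i) + real (\<gamma> i)) * falling d \<gamma> \<alpha>"
  unfolding falling_def by (subst vpochhammer_upd_Suc) auto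

lemma rising_step:
  "i < d + 1 \<Longrightarrow> rising d \<kappa> (\<gamma>(i := Suc (\<gamma> i))) \<alpha> =
     (1 * real (\<alpha> i) + (\<kappa> i + 1 + real (\<gamma> i))) * rising d \<kappa> \<gamma> \<alpha>"
  unfolding rising_def by (subst vpochhammer_upd_Suc) (auto simp: algebra_simps)

lemma span_monomial_mult_affine:
  "f \<in> sspan S (monomial d) (upto_indices d m) \<Longrightarrow> i < d \<Longrightarrow>
    (\<lambda>\<alpha>. (u * real (\<alpha> i) + v) * f \<alpha>) \<in> sspan S (monomial d) (upto_indices d (Suc m))"
  by (rule sspan_mult_affine[OF monomial_step]; (assumption | simp))

lemma span_falling_mult_affine:
  "f \<in> sspan S (falling d) (upto_indices (d + 1) m) \<Longrightarrow> i < d + 1 \<Longrightarrow>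
    (\<lambda>\<alpha>. (u * real (\<alpha> i) + v) * f \<alpha>) \<in> sspan S (falling d) (upto_indices (d + 1) (Suc m))"
  by (rule sspan_mult_affine[OF falling_step]; (assumption | simp))

lemma span_rising_mult_affine:
  "f \<in> sspan S (rising d \<kappa>) (upto_indices (d + 1) m) \<Longrightarrow> i < d + 1 \<Longrightarrow>
    (\<lambda>\<alpha>. (u * real (\<alpha> i) + v) * f \<alpha>) \<in> sspan S (rising d \<kappa>) (upto_indices (d + 1) (Suc m))"
  by (rule sspan_mult_affine[OF rising_step]; (assumption | simp))

text \<open>On the grid, the last coordinate is \<open>N\<close> minus the sum of the other ones.\<close>

lemma grid_polys_mult_affine:
  assumes f: "f \<in> grid_polys d N m" and i: "i < d + 1"
  shows "(\<lambda>\<alpha>. (u * real (\<alpha> i) + v) * f \<alpha>) \<in> grid_polys d N (Suc m)"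
proof (cases "i < d")
  case True
  show ?thesis using f True unfolding grid_polys_eq by (rule span_monomial_mult_affine)
next
  case False
  then have i: "i = d" using i by simp
  have f': "f \<in> grid_polys d N (Suc m)"
    using f unfolding grid_polys_eq by (rule sspan_upto_mono) simp
  have "(\<lambda>\<alpha>. \<Sum>l<d. 1 * ((1 * real (\<alpha> l) + 0) * f \<alpha>)) \<in> grid_polys d N (Suc m)"
    unfolding grid_polys_eq
    by (intro sspan_sum span_monomial_mult_affine) (use f in \<open>auto simp: grid_polys_eq\<close>)
  \<comment> \<open>The coefficients come from substituting N minus the other coordinates for the
    last one in the affine factor.\<close>
  then have "(\<lambda>\<alpha>. (- u) * (\<Sum>l<d. 1 * ((1 * real (\<alpha> l) + 0) * f \<alpha>)) + (u * real N + v) * f \<alpha>)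
      \<in> grid_polys d N (Suc m)"
    using f' unfolding grid_polys_eq by (rule sspan_lin)
  then show ?thesis unfolding grid_polys_eq
  proof (rule sspan_cong)
    fix \<alpha> assume "\<alpha> \<in> hahn_grid d N"
    then have "real N = (\<Sum>l<d. real (\<alpha> l)) + real (\<alpha> d)"
      by (auto simp: multi_indices_def)
    then show "(- u) * (\<Sum>l<d. 1 * ((1 * real (\<alpha> l) + 0) * f \<alpha>)) + (u * real N + v) * f \<alpha> =
        (u * real (\<alpha> i) + v) * f \<alpha>"
      by (simp add: i algebra_simps flip: sum_distrib_left)
  qed
qed

lemma sspan_const_1:
  assumes "\<And>\<alpha>. b (\<lambda>_. 0) \<alpha> = 1" shows "(\<lambda>_. 1) \<in> sspan S b (upto_indices D 0)"
proof -
  have "b (\<lambda>_. 0) \<in> sspan S b (upto_indices D 0)"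
    by (rule sspan_base) (auto simp: upto_indices_0)
  then show ?thesis by (rule sspan_cong) (simp add: assms)
qed

lemma falling_0: "falling d (\<lambda>_. 0) \<alpha> = 1" and rising_0: "rising d \<kappa> (\<lambda>_. 0) \<alpha> = 1"
  and monomial_0: "monomial d (\<lambda>_. 0) \<alpha> = 1"
  by (simp_all add: falling_def rising_def monomial_def vpochhammer_def)

lemma falling_in_grid_polys:
  assumes "\<gamma> \<in> multi_indices (d + 1) k"
  shows "falling d \<gamma> \<in> grid_polys d N k"
proof (rule graded_family_mem[where P = "grid_polys d N", OF _ falling_step _ assms])
  have "(\<lambda>_. 1) \<in> grid_polys d N 0"
    unfolding grid_polys_eq by (rule sspan_const_1) (rule monomial_0)
  then show "falling d (\<lambda>_. 0) \<in> grid_polys d N 0"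
    by (simp add: falling_0[abs_def])
qed (assumption | rule grid_polys_mult_affine)+

lemma rising_in_span_falling:
  assumes "\<gamma> \<in> multi_indices (d + 1) k"
  shows "rising d \<kappa> \<gamma> \<in> sspan S (falling d) (upto_indices (d + 1) k)"
proof (rule graded_family_mem[where P = "\<lambda>k. sspan S (falling d) (upto_indices (d + 1) k)", OF _ rising_step _ assms])
  have "(\<lambda>_. 1) \<in> sspan S (falling d) (upto_indices (d + 1) 0)"
    by (rule sspan_const_1) (rule falling_0)
  then show "rising d \<kappa> (\<lambda>_. 0) \<in> sspan S (falling d) (upto_indices (d + 1) 0)"
    by (simp add: rising_0[abs_def])
qed (assumption | rule span_falling_mult_affine)+

lemma monomial_in_span_rising:
  assumes "\<gamma> \<in> multi_indices d k"
  shows "monomial d \<gamma> \<in> sspan S (rising d \<kappa>) (upto_indices (d + 1) k)"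
proof (rule graded_family_mem[where P = "\<lambda>k. sspan S (rising d \<kappa>) (upto_indices (d + 1) k)", OF _ monomial_step _ assms])
  have "(\<lambda>_. 1) \<in> sspan S (rising d \<kappa>) (upto_indices (d + 1) 0)"
    by (rule sspan_const_1) (rule rising_0)
  then show "monomial d (\<lambda>_. 0) \<in> sspan S (rising d \<kappa>) (upto_indices (d + 1) 0)"
    by (simp add: monomial_0[abs_def])
qed (assumption | rule span_rising_mult_affine | simp)+

text \<open>Allows orthogonality and reproduction to be checked on \<open>rising\<close> alone,
  whose pairing with \<open>falling\<close> has a closed form.\<close>

lemma grid_polys_subset_span_rising:
  "grid_polys d N m \<subseteq> sspan (hahn_grid d N) (rising d \<kappa>) (upto_indices (d + 1) m)"
proof
  fix f assume "f \<in> grid_polys d N m"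
  then obtain c where c: "\<And>\<alpha>. \<alpha> \<in> hahn_grid d N \<Longrightarrow> f \<alpha> = (\<Sum>\<gamma>\<in>upto_indices d m. c \<gamma> * monomial d \<gamma> \<alpha>)"
    by (auto simp: grid_polys_eq sspan_def)
  have mem: "monomial d \<gamma> \<in> sspan (hahn_grid d N) (rising d \<kappa>) (upto_indices (d + 1) m)"
    if \<gamma>: "\<gamma> \<in> upto_indices d m" for \<gamma>
  proof -
    obtain k where k: "k \<le> m" "\<gamma> \<in> multi_indices d k" using \<gamma> by (auto simp: upto_indices_iff)
    show ?thesis by (rule sspan_upto_mono[OF monomial_in_span_rising[OF k(2)] k(1)])
  qed
  have "(\<lambda>\<alpha>. \<Sum>\<gamma>\<in>upto_indices d m. c \<gamma> * monomial d \<gamma> \<alpha>)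
      \<in> sspan (hahn_grid d N) (rising d \<kappa>) (upto_indices (d + 1) m)"
    by (rule sspan_sum[OF finite_upto_indices mem])
  then show "f \<in> sspan (hahn_grid d N) (rising d \<kappa>) (upto_indices (d + 1) m)"
    by (rule sspan_cong) (simp add: c)
qed

section \<open>The univariate sum behind the eigenvalues\<close>

text \<open>
  Shifting the summation index by \<open>j\<close> turns this into a Chu-Vandermonde sum with the parameters
  \<open>-(n - j)\<close>, \<open>n + a - 1 + j\<close> and \<open>a + j + m\<close>.
\<close>

lemma kernel_eigenvalue_sum:
  fixes a :: real
  assumes a: "a > 0" and le: "j \<le> m" "m \<le> n" "n \<le> N"
  shows "(\<Sum>k=0..n. pochhammer (- real n) k * pochhammer (real n + a - 1) k /
        (pochhammer (- real N) k * pochhammer (- real N) k) *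
      (if j \<le> k then fact N / pochhammer a N * (-1) ^ k *
         (pochhammer (a + real (k + m)) (N - k) / fact (N - k)) *
         ((-1) ^ j * (pochhammer (real j - real N) (k - j) / fact (k - j))) else 0)) =
    (-1) ^ j * pochhammer a (N + m) / (pochhammer a N * pochhammer (- real N) j) *
      (pochhammer (- real n) j * pochhammer (real n + a - 1) j / pochhammer a (j + m)) *
      (pochhammer (1 + real m - real n) (n - j) / pochhammer (a + real (j + m)) (n - j))"
    (is "(\<Sum>k=0..n. ?f k) = ?C * ?D * ?V")
proof -
  have "(\<Sum>k=0..n. ?f k) = (\<Sum>k=j..n. ?f k)"
    by (rule sum.mono_neutral_right) auto
  also have "{j..n} = {0+j..n-j+j}" using le by simp
  also have "(\<Sum>k=0+j..n-j+j. ?f k) = (\<Sum>i=0..n-j. ?f (i + j))"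
    by (rule sum.shift_bounds_cl_nat_ivl)
  also have "\<dots> = (\<Sum>i=0..n-j. ?C * ?D * (pochhammer (real n + a - 1 + real j) i * pochhammer (- real (n - j)) i /
      (of_nat (fact i) * pochhammer (a + real (j + m)) i)))"
  proof (rule sum.cong[OF refl])
    fix i assume i: "i \<in> {0..n-j}"
    define k where "k = j + i"
    have k: "j \<le> k" "k \<le> n" "k \<le> N" "k - j = i" using i le by (auto simp: k_def)
    \<comment> \<open>Absorbs the sign and the quotient of factorials into a symbol that cancels one
      of the two equal denominators. It is nonzero because k \<le> N.\<close>
    have X: "pochhammer (- real N) k = (-1) ^ k * fact N / fact (N - k)"
      using pochhammer_minus_of_nat_eq[of "N - k" k] k by simp
    then have X0: "pochhammer (- real N) k \<noteq> 0" by simp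
    have Y: "pochhammer (- real N) k = pochhammer (- real N) j * pochhammer (real j - real N) i"
      unfolding k_def by (simp add: pochhammer_product')
    have Y0: "pochhammer (- real N) j \<noteq> 0" using X0 Y by auto
    have A: "pochhammer a (N + m) = pochhammer a (k + m) * pochhammer (a + real (k + m)) (N - k)"
      using pochhammer_product[of "k + m" "N + m" a] k by simp
    have B: "pochhammer a (k + m) = pochhammer a (j + m) * pochhammer (a + real (j + m)) i"
      using pochhammer_product'[of a "j + m" i] by (simp add: k_def add_ac)
    have pos: "pochhammer a (j + m) > 0" "pochhammer (a + real (j + m)) i > 0" "pochhammer a N > 0"
      using a by (auto intro!: pochhammer_pos)
    have n1: "pochhammer (- real n) k = pochhammer (- real n) j * pochhammer (- real (n - j)) i"
      using le unfolding k_def by (simp add: pochhammer_product' of_nat_diff)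
    have n2: "pochhammer (real n + a - 1) k = pochhammer (real n + a - 1) j * pochhammer (real n + a - 1 + real j) i"
      unfolding k_def by (simp add: pochhammer_product')
    have A': "pochhammer (a + real (k + m)) (N - k) = pochhammer a (N + m) / pochhammer a (k + m)"
      using A B pos by simp
    have Y': "pochhammer (real j - real N) i = pochhammer (- real N) k / pochhammer (- real N) j"
      using Y Y0 by simp
    have "?f k = pochhammer (- real n) k * pochhammer (real n + a - 1) k /
        (pochhammer (- real N) k * pochhammer (- real N) k) *
        (pochhammer (- real N) k / pochhammer a N * pochhammer (a + real (k + m)) (N - k) *
         ((-1) ^ j * (pochhammer (real j - real N) i / fact i)))"
      using k unfolding X by (simp add: mult_ac)
    also have "\<dots> = ?C * ?D * (pochhammer (real n + a - 1 + real j) i * pochhammer (- real (n - j)) i /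
        (of_nat (fact i) * pochhammer (a + real (j + m)) i))"
      using X0 Y0 pos unfolding A' Y' B n1 n2 by (simp add: field_simps)
    finally show "?f (i + j) = \<dots>"
      by (simp only: k_def add.commute[of i j])
  qed
  also have "\<dots> = ?C * ?D * (\<Sum>i=0..n-j. (pochhammer (real n + a - 1 + real j) i * pochhammer (- of_nat (n - j)) i /
      (of_nat (fact i) * pochhammer (a + real (j + m)) i)))"
    by (simp only: sum_distrib_left)
  also have "\<dots> = ?C * ?D * ?V"
    \<comment> \<open>The numerator parameter is a + j + m minus n + a - 1 + j, that is, 1 + m - n.
      Positivity of \<open>a\<close> keeps the denominators nonzero.\<close>
    by (subst Vandermonde_pochhammer) (use a in \<open>auto simp: algebra_simps add_eq_0_iff2\<close>)
  finally show ?thesis .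
qed

section \<open>The Hahn inner product and its values on falling and rising products\<close>

locale hahn =
  fixes d N :: nat and \<kappa> :: "nat \<Rightarrow> real"
  assumes \<kappa>: "\<forall>i\<le>d. \<kappa> i > -1"
begin

definition A :: real where
  "A = vsum d \<kappa> + real d + 1"

text \<open>The normalizing constant is included, so that the Hahn inner product becomes a plain
  \<open>wip\<close>.\<close>

definition weight :: "(nat \<Rightarrow> nat) \<Rightarrow> real" where
  "weight \<alpha> = fact N / pochhammer A N * (vpochhammer d (\<lambda>i. \<kappa> i + 1) \<alpha> / vfact d \<alpha>)"

lemma \<kappa>_pos: "i < d + 1 \<Longrightarrow> \<kappa> i + 1 > 0"
  using \<kappa>[rule_format, of i] by simp

lemma sum_\<kappa>: "(\<Sum>i<d + 1. \<kappa> i + 1) = A"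
  by (simp add: A_def vsum_def sum.distrib)

lemma A_pos: "A > 0"
  unfolding sum_\<kappa>[symmetric] by (rule sum_pos) (use \<kappa>_pos in auto)

lemma weight_pos: "weight \<alpha> > 0"
  unfolding weight_def
  by (intro mult_pos_pos divide_pos_pos vpochhammer_pos vfact_pos pochhammer_pos A_pos \<kappa>_pos) auto

lemma hahn_inner_eq_wip: "hahn_inner d \<kappa> N f g = wip (hahn_grid d N) weight f g"
  by (simp add: hahn_inner_def wip_def weight_def A_def sum_distrib_left mult_ac)

lemma hahn_inner_commute: "hahn_inner d \<kappa> N f g = hahn_inner d \<kappa> N g f"
  by (simp add: hahn_inner_eq_wip wip_commute)

lemma hahn_inner_cong:
  "(\<And>\<alpha>. \<alpha> \<in> hahn_grid d N \<Longrightarrow> f \<alpha> = f' \<alpha>) \<Longrightarrow> (\<And>\<alpha>. \<alpha> \<in> hahn_grid d N \<Longrightarrow> g \<alpha> = g' \<alpha>) \<Longrightarrow>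
    hahn_inner d \<kappa> N f g = hahn_inner d \<kappa> N f' g'"
  unfolding hahn_inner_eq_wip by (rule wip_cong)

lemma hahn_inner_sum_left:
  "hahn_inner d \<kappa> N (\<lambda>\<alpha>. \<Sum>i\<in>I. c i * b i \<alpha>) g = (\<Sum>i\<in>I. c i * hahn_inner d \<kappa> N (b i) g)"
proof -
  have "hahn_inner d \<kappa> N (\<lambda>\<alpha>. \<Sum>i\<in>I. c i * b i \<alpha>) g =
      (\<Sum>\<alpha>\<in>hahn_grid d N. \<Sum>i\<in>I. c i * (weight \<alpha> * b i \<alpha> * g \<alpha>))"
    by (simp add: hahn_inner_eq_wip wip_def sum_distrib_left sum_distrib_right mult_ac)
  then show ?thesis
    by (subst (asm) sum.swap) (simp add: hahn_inner_eq_wip wip_def sum_distrib_left)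
qed

lemma hahn_inner_sum_right:
  "hahn_inner d \<kappa> N g (\<lambda>\<alpha>. \<Sum>i\<in>I. c i * b i \<alpha>) = (\<Sum>i\<in>I. c i * hahn_inner d \<kappa> N g (b i))"
  by (simp add: hahn_inner_commute[of g] hahn_inner_sum_left)

text \<open>An instance of \<open>sum_vpochhammer_mult\<close> with parameters \<kappa>_i + 1, whose
  total is \<open>A\<close>.\<close>

lemma hahn_inner_falling_rising:
  assumes "\<gamma> \<in> multi_indices (d + 1) k" "\<delta> \<in> multi_indices (d + 1) m" "k \<le> N"
  shows "hahn_inner d \<kappa> N (falling d \<gamma>) (rising d \<kappa> \<delta>) =
    fact N / pochhammer A N * (-1) ^ k * (pochhammer (A + real (k + m)) (N - k) / fact (N - k)) *
      vpochhammer d (\<lambda>i. \<kappa> i + 1) (\<lambda>i. \<gamma> i + \<delta> i)"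
proof -
  have "hahn_inner d \<kappa> N (falling d \<gamma>) (rising d \<kappa> \<delta>) = fact N / pochhammer A N *
      (\<Sum>\<alpha>\<in>hahn_grid d N. vpochhammer d (\<lambda>i. \<kappa> i + 1) \<alpha> / vfact d \<alpha> *
      vpochhammer d (\<lambda>i. - real (\<alpha> i)) \<gamma> * vpochhammer d (\<lambda>i. \<kappa> i + 1 + real (\<alpha> i)) \<delta>)"
    by (simp add: hahn_inner_def A_def falling_def rising_def mult_ac)
  then show ?thesis
    unfolding sum_vpochhammer_mult[OF assms(1,2)] sum_\<kappa> using assms(3) by simp
qed

text \<open>The symbol of degree \<gamma> + \<delta> from the pairing factors by
  \<open>vpochhammer_add\<close>: one factor cancels the denominator in \<open>hahn_E\<close>, the
  other is \<open>rising\<close> evaluated at the index \<gamma>.\<close>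

lemma hahn_inner_E_rising:
  assumes \<delta>: "\<delta> \<in> multi_indices (d + 1) m" and k: "k \<le> N"
  shows "hahn_inner d \<kappa> N (hahn_E d \<kappa> k x) (rising d \<kappa> \<delta>) =
    fact N / pochhammer A N * (-1) ^ k * (pochhammer (A + real (k + m)) (N - k) / fact (N - k)) *
      (\<Sum>\<gamma>\<in>multi_indices (d + 1) k.
        vpochhammer d (\<lambda>i. - real (x i)) \<gamma> / vfact d \<gamma> * rising d \<kappa> \<delta> \<gamma>)"
    (is "_ = ?c * _")
proof -
  have E: "hahn_E d \<kappa> k x = (\<lambda>y. \<Sum>\<gamma>\<in>multi_indices (d + 1) k.
      vpochhammer d (\<lambda>i. - real (x i)) \<gamma> / (vpochhammer d (\<lambda>i. \<kappa> i + 1) \<gamma> * vfact d \<gamma>) * falling d \<gamma> y)"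
    by (simp add: hahn_E_def falling_def fun_eq_iff)
  have "vpochhammer d (\<lambda>i. - real (x i)) \<gamma> / (vpochhammer d (\<lambda>i. \<kappa> i + 1) \<gamma> * vfact d \<gamma>) *
        hahn_inner d \<kappa> N (falling d \<gamma>) (rising d \<kappa> \<delta>) =
      ?c * (vpochhammer d (\<lambda>i. - real (x i)) \<gamma> / vfact d \<gamma> * rising d \<kappa> \<delta> \<gamma>)"
    if \<gamma>: "\<gamma> \<in> multi_indices (d + 1) k" for \<gamma>
  proof -
    have "vpochhammer d (\<lambda>i. \<kappa> i + 1) \<gamma> > 0"
      using \<kappa>_pos by (rule vpochhammer_pos)
    then show ?thesis
      unfolding hahn_inner_falling_rising[OF \<gamma> \<delta> k] vpochhammer_add rising_def by (simp add: mult_ac)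
  qed
  then show ?thesis
    unfolding E hahn_inner_sum_left sum_distrib_left by (intro sum.cong refl)
qed

text \<open>The same summation identity with parameters -x_i and \<delta> = 0. On the grid the
  parameters add up to -N, so the scalar depends on \<epsilon> only through its degree.\<close>

lemma sum_falling:
  assumes x: "x \<in> hahn_grid d N" and \<epsilon>: "\<epsilon> \<in> multi_indices (d + 1) j"
  shows "(\<Sum>\<gamma>\<in>multi_indices (d + 1) k. vpochhammer d (\<lambda>i. - real (x i)) \<gamma> / vfact d \<gamma> * falling d \<epsilon> \<gamma>) =
    (if j \<le> k then (-1) ^ j * (pochhammer (real j - real N) (k - j) / fact (k - j)) else 0) * falling d \<epsilon> x"
proof -
  have "(\<Sum>i<d + 1. - real (x i)) = - real N"
    using x by (auto simp: multi_indices_def sum_negf)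
  moreover have "(\<lambda>_. 0) \<in> multi_indices (d + 1) 0" by (simp add: multi_indices_0)
  ultimately show ?thesis
    using sum_vpochhammer_mult[OF \<epsilon>, of "\<lambda>_. 0" 0 "\<lambda>i. - real (x i)" k]
    by (simp add: vpochhammer_def[of _ _ "\<lambda>_. 0"] falling_def)
qed

section \<open>The candidate kernel and its eigenvalues\<close>

text \<open>The case n = 0 is separate because the quotient would otherwise be 0/0, hence 0, when
  \<open>A = 1\<close>.\<close>

definition kernel_coeff :: "nat \<Rightarrow> real" where
  "kernel_coeff n = pochhammer (- real N) n * pochhammer A N * pochhammer A n
      / (fact n * pochhammer A (N + n))
    * (if n = 0 then 1 else (A - 1 + 2 * real n) / (A - 1 + real n))"

definition kernel :: "nat \<Rightarrow> (nat \<Rightarrow> nat) \<Rightarrow> (nat \<Rightarrow> nat) \<Rightarrow> real" where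
  "kernel n x y = kernel_coeff n *
    (\<Sum>k=0..n. pochhammer (- real n) k * pochhammer (real n + A - 1) k
          / (pochhammer (- real N) k * pochhammer (- real N) k) * hahn_E d \<kappa> k x y)"

text \<open>
  The map \<open>f \<mapsto> \<langle>kernel n x, f\<rangle>\<close> is triangular from the functions \<open>rising\<close> of
  degree \<open>m\<close> to the functions \<open>falling\<close>: the coefficients in degree \<open>j\<close> of the
  expansion into \<open>falling\<close> get multiplied by \<open>eigenvalue n m j\<close>.
\<close>

definition eigenvalue :: "nat \<Rightarrow> nat \<Rightarrow> nat \<Rightarrow> real" where
  "eigenvalue n m j = kernel_coeff n *
    ((-1) ^ j * pochhammer A (N + m) / (pochhammer A N * pochhammer (- real N) j) *
      (pochhammer (- real n) j * pochhammer (real n + A - 1) j / pochhammer A (j + m)) *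
      (pochhammer (1 + real m - real n) (n - j) / pochhammer (A + real (j + m)) (n - j)))"

text \<open>After expanding \<open>rising\<close> into \<open>falling\<close>, the sum over \<gamma>
  returns each \<open>falling\<close> function at \<open>x\<close> up to a scalar. Collecting these
  scalars over k leaves the sum of \<open>kernel_eigenvalue_sum\<close>.\<close>

lemma hahn_inner_kernel_rising:
  assumes x: "x \<in> hahn_grid d N" and \<delta>: "\<delta> \<in> multi_indices (d + 1) m" and le: "m \<le> n" "n \<le> N"
    and c: "\<And>\<alpha>. rising d \<kappa> \<delta> \<alpha> = (\<Sum>\<epsilon>\<in>upto_indices (d + 1) m. c \<epsilon> * falling d \<epsilon> \<alpha>)"
  shows "hahn_inner d \<kappa> N (kernel n x) (rising d \<kappa> \<delta>) =
    (\<Sum>\<epsilon>\<in>upto_indices (d + 1) m. c \<epsilon> * eigenvalue n m (\<Sum>i<d + 1. \<epsilon> i) * falling d \<epsilon> x)"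
proof -
  \<comment> \<open>Here \<open>w\<close> is the coefficient of E_k in the kernel,
    \<open>\<mu>\<close> comes from the inner product in y, and \<open>\<nu>\<close> from the sum
    over \<gamma>.\<close>
  define w where "w k = pochhammer (- real n) k * pochhammer (real n + A - 1) k
    / (pochhammer (- real N) k * pochhammer (- real N) k)" for k
  define \<mu> where "\<mu> k = fact N / pochhammer A N * (-1) ^ k *
    (pochhammer (A + real (k + m)) (N - k) / fact (N - k))" for k
  define \<nu> where "\<nu> k j = (if j \<le> k then (-1) ^ j * (pochhammer (real j - real N) (k - j) / fact (k - j)) else 0)"
    for k j
  have E: "hahn_inner d \<kappa> N (hahn_E d \<kappa> k x) (rising d \<kappa> \<delta>) =
      (\<Sum>\<epsilon>\<in>upto_indices (d + 1) m. c \<epsilon> * (\<mu> k * \<nu> k (\<Sum>i<d + 1. \<epsilon> i)) * falling d \<epsilon> x)"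
    if k: "k \<le> n" for k
  proof -
    have \<nu>: "(\<Sum>\<gamma>\<in>multi_indices (d + 1) k. vpochhammer d (\<lambda>i. - real (x i)) \<gamma> / vfact d \<gamma> * falling d \<epsilon> \<gamma>) =
        \<nu> k (\<Sum>i<d + 1. \<epsilon> i) * falling d \<epsilon> x" if "\<epsilon> \<in> upto_indices (d + 1) m" for \<epsilon>
    proof -
      have "\<epsilon> \<in> multi_indices (d + 1) (\<Sum>i<d + 1. \<epsilon> i)"
        using that by (auto simp: upto_indices_iff multi_indices_def)
      then show ?thesis unfolding \<nu>_def by (rule sum_falling[OF x])
    qed
    have "hahn_inner d \<kappa> N (hahn_E d \<kappa> k x) (rising d \<kappa> \<delta>) =
        \<mu> k * (\<Sum>\<gamma>\<in>multi_indices (d + 1) k. \<Sum>\<epsilon>\<in>upto_indices (d + 1) m.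
          c \<epsilon> * (vpochhammer d (\<lambda>i. - real (x i)) \<gamma> / vfact d \<gamma> * falling d \<epsilon> \<gamma>))"
      using k le by (subst hahn_inner_E_rising[OF \<delta>]) (simp_all add: c \<mu>_def sum_distrib_left mult_ac)
    also have "\<dots> = \<mu> k * (\<Sum>\<epsilon>\<in>upto_indices (d + 1) m. c \<epsilon> * (\<nu> k (\<Sum>i<d + 1. \<epsilon> i) * falling d \<epsilon> x))"
      by (subst sum.swap) (simp only: \<nu> cong: sum.cong flip: sum_distrib_left)
    finally show ?thesis by (simp add: sum_distrib_left mult_ac)
  qed
  have eig: "kernel_coeff n * (\<Sum>k=0..n. w k * (\<mu> k * \<nu> k (\<Sum>i<d + 1. \<epsilon> i))) =
      eigenvalue n m (\<Sum>i<d + 1. \<epsilon> i)" if "\<epsilon> \<in> upto_indices (d + 1) m" for \<epsilon>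
  proof -
    have "(\<Sum>i<d + 1. \<epsilon> i) \<le> m"
      using that by (auto simp: upto_indices_iff multi_indices_def)
    from kernel_eigenvalue_sum[OF A_pos this le] show ?thesis
      unfolding eigenvalue_def w_def \<mu>_def \<nu>_def
      by (simp only: if_distrib[of "(*) _"] mult_zero_right)
  qed
  have "hahn_inner d \<kappa> N (kernel n x) (rising d \<kappa> \<delta>) =
      (\<Sum>k=0..n. (kernel_coeff n * w k) * hahn_inner d \<kappa> N (hahn_E d \<kappa> k x) (rising d \<kappa> \<delta>))"
    unfolding hahn_inner_sum_left[symmetric] kernel_def[abs_def]
    by (simp add: w_def sum_distrib_left mult_ac)
  also have "\<dots> = (\<Sum>k=0..n. \<Sum>\<epsilon>\<in>upto_indices (d + 1) m.
      c \<epsilon> * (kernel_coeff n * (w k * (\<mu> k * \<nu> k (\<Sum>i<d + 1. \<epsilon> i)))) * falling d \<epsilon> x)"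
    by (intro sum.cong refl) (simp add: E sum_distrib_left mult_ac)
  also have "\<dots> = (\<Sum>\<epsilon>\<in>upto_indices (d + 1) m.
      c \<epsilon> * (kernel_coeff n * (\<Sum>k=0..n. w k * (\<mu> k * \<nu> k (\<Sum>i<d + 1. \<epsilon> i)))) * falling d \<epsilon> x)"
    by (subst sum.swap) (simp only: sum_distrib_left sum_distrib_right)
  also have "\<dots> = (\<Sum>\<epsilon>\<in>upto_indices (d + 1) m. c \<epsilon> * eigenvalue n m (\<Sum>i<d + 1. \<epsilon> i) * falling d \<epsilon> x)"
    by (intro sum.cong refl) (simp only: eig)
  finally show ?thesis .
qed

text \<open>The Chu-Vandermonde numerator starts at -(n - m - 1) and has n - j > n - m - 1 factors,
  one of which is 0.\<close>

lemma eigenvalue_eq_0: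
  assumes "j \<le> m" "m < n" shows "eigenvalue n m j = 0"
proof -
  obtain p where p: "n = m + 1 + p" using assms(2) by (metis Suc_eq_plus1 less_iff_Suc_add add_Suc)
  have "pochhammer (- real p) (n - j) = 0"
    unfolding pochhammer_of_nat_eq_0_iff using assms p by linarith
  moreover have "1 + real m - real n = - real p" by (simp add: p)
  ultimately show ?thesis by (simp only: eigenvalue_def div_0 mult_zero_right)
qed

text \<open>This is what the constant in front of the kernel is chosen for. The Chu-Vandermonde
  factor is an empty product here, and the rest cancels.\<close>

lemma eigenvalue_eq_1:
  assumes "n \<le> N" shows "eigenvalue n n n = 1"
proof (cases "n = 0")
  case True
  have "pochhammer A N > 0" using A_pos by (rule pochhammer_pos)
  then show ?thesis using True by (simp add: eigenvalue_def kernel_coeff_def)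
next
  case False
  have pos: "pochhammer A k > 0" for k
    using A_pos by (rule pochhammer_pos)
  have 1: "pochhammer (- real N) n \<noteq> 0"
    using assms by (simp add: pochhammer_of_nat_eq_0_iff)
  have Z_eq: "real n + A - 1 = A - 1 + real n" by simp
  \<comment> \<open>Uses n \<ge> 1; at n = 0 the value A - 1 may be zero or negative.\<close>
  have Z: "A - 1 + real n > 0" using A_pos False by (cases n) auto
  have "pochhammer (A - 1 + real n) n * (A - 1 + 2 * real n) = pochhammer (A - 1 + real n) (Suc n)"
    by (simp add: pochhammer_Suc)
  also have "\<dots> = (A - 1 + real n) * pochhammer (A + real n) n"
    by (simp add: pochhammer_rec add.commute)
  finally have z: "pochhammer (A - 1 + real n) n * ((A - 1 + 2 * real n) / (A - 1 + real n)) =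
      pochhammer (A + real n) n"
    using Z by (subst times_divide_eq_right) simp
  \<comment> \<open>The cancellation with symbols as variables: X is (-N)_n, p is A_N, u is A_n, v
    is A_(N+n), r is A_(2n), z is (A - 1 + n)_n, f is n!, s is the sign and q the quotient rewritten
    in \<open>z\<close>.\<close>
  have alg: "X * p * u / (f * v) * q * (s * v / (p * X) * (s * f * z / r) * 1) = u * (z * q) / r * (s * s)"
    if "X \<noteq> 0" "p \<noteq> 0" "v \<noteq> 0" "f \<noteq> 0" for X p u f v q s z r :: real
    using that by simp
  have "eigenvalue n n n = pochhammer (- real N) n * pochhammer A N * pochhammer A n /
      (fact n * pochhammer A (N + n)) * ((A - 1 + 2 * real n) / (A - 1 + real n)) *
      ((-1) ^ n * pochhammer A (N + n) / (pochhammer A N * pochhammer (- real N) n) *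
       ((-1) ^ n * fact n * pochhammer (A - 1 + real n) n / pochhammer A (n + n)) * 1)"
    unfolding eigenvalue_def kernel_coeff_def pochhammer_same Z_eq if_not_P[OF False]
    by (simp only: add_diff_cancel_right' diff_self_eq_0 pochhammer_0 div_by_1)
  also have "\<dots> = pochhammer A n * pochhammer (A + real n) n / pochhammer A (n + n) * ((-1) ^ n * (-1) ^ n)"
    unfolding z[symmetric] by (rule alg) (use pos[of N] pos[of "N + n"] 1 in auto)
  also have "\<dots> = 1"
    using pos[of "n + n"] by (simp add: pochhammer_product'[symmetric] flip: power_mult_distrib)
  finally show ?thesis .
qed

section \<open>Membership in the Hahn space and the reproducing property\<close>

lemma kernel_sym: "kernel n x y = kernel n y x"
  by (simp add: kernel_def hahn_E_def mult_ac)

lemma kernel_in_grid_polys: "kernel n x \<in> grid_polys d N n"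
proof -
  have "hahn_E d \<kappa> k x \<in> grid_polys d N n" if k: "k \<le> n" for k
  proof -
    have "falling d \<gamma> \<in> grid_polys d N n" if "\<gamma> \<in> multi_indices (d + 1) k" for \<gamma>
      using falling_in_grid_polys[OF that] k unfolding grid_polys_eq by (rule sspan_upto_mono)
    then have "(\<lambda>y. \<Sum>\<gamma>\<in>multi_indices (d + 1) k. vpochhammer d (\<lambda>i. - real (x i)) \<gamma> /
        (vpochhammer d (\<lambda>i. \<kappa> i + 1) \<gamma> * vfact d \<gamma>) * falling d \<gamma> y) \<in> grid_polys d N n"
      unfolding grid_polys_eq by (intro sspan_sum finite_multi_indices)
    then show ?thesis unfolding grid_polys_eq
      by (rule sspan_cong) (simp add: hahn_E_def falling_def)
  qed
  then have "(\<lambda>y. \<Sum>k=0..n. kernel_coeff n * (pochhammer (- real n) k * pochhammer (real n + A - 1) k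
      / (pochhammer (- real N) k * pochhammer (- real N) k)) * hahn_E d \<kappa> k x y) \<in> grid_polys d N n"
    unfolding grid_polys_eq by (intro sspan_sum) auto
  then show ?thesis unfolding grid_polys_eq
    by (rule sspan_cong) (simp only: kernel_def sum_distrib_left mult.assoc)
qed

text \<open>Taken over \<open>UNIV\<close> rather than the grid, because the expansion is also
  evaluated at the indices \<gamma> of E_k, whose sum is k and not N.\<close>

lemma rising_expansion:
  assumes "\<delta> \<in> multi_indices (d + 1) m"
  shows "\<exists>c. \<forall>\<alpha>. rising d \<kappa> \<delta> \<alpha> = (\<Sum>\<epsilon>\<in>upto_indices (d + 1) m. c \<epsilon> * falling d \<epsilon> \<alpha>)"
  using rising_in_span_falling[OF assms, of \<kappa> UNIV] by (simp add: sspan_def)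

lemma hahn_inner_kernel_rising_eq_0:
  assumes x: "x \<in> hahn_grid d N" and \<delta>: "\<delta> \<in> multi_indices (d + 1) m" and le: "m < n" "n \<le> N"
  shows "hahn_inner d \<kappa> N (kernel n x) (rising d \<kappa> \<delta>) = 0"
proof -
  obtain c where c: "\<And>\<alpha>. rising d \<kappa> \<delta> \<alpha> = (\<Sum>\<epsilon>\<in>upto_indices (d + 1) m. c \<epsilon> * falling d \<epsilon> \<alpha>)"
    using rising_expansion[OF \<delta>] by blast
  have eig: "eigenvalue n m (\<Sum>i<d + 1. \<epsilon> i) = 0" if \<epsilon>: "\<epsilon> \<in> upto_indices (d + 1) m" for \<epsilon>
  proof (rule eigenvalue_eq_0[OF _ le(1)])
    show "(\<Sum>i<d + 1. \<epsilon> i) \<le> m"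
      using \<epsilon> by (auto simp: upto_indices_iff multi_indices_def)
  qed
  have "hahn_inner d \<kappa> N (kernel n x) (rising d \<kappa> \<delta>) =
      (\<Sum>\<epsilon>\<in>upto_indices (d + 1) m. c \<epsilon> * eigenvalue n m (\<Sum>i<d + 1. \<epsilon> i) * falling d \<epsilon> x)"
    by (rule hahn_inner_kernel_rising[OF x \<delta> less_imp_le[OF le(1)] le(2) c])
  also have "\<dots> = 0"
    by (intro sum.neutral ballI) (simp only: eig mult_zero_left mult_zero_right)
  finally show ?thesis .
qed

lemma kernel_in_hahn_space:
  assumes x: "x \<in> hahn_grid d N" and n: "n \<le> N"
  shows "kernel n x \<in> hahn_space d \<kappa> N n"
proof -
  have "hahn_inner d \<kappa> N (kernel n x) g = 0" if m: "m < n" and g: "g \<in> grid_polys d N m" for m g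
  proof -
    obtain c where c: "\<And>\<alpha>. \<alpha> \<in> hahn_grid d N \<Longrightarrow> g \<alpha> = (\<Sum>\<delta>\<in>upto_indices (d + 1) m. c \<delta> * rising d \<kappa> \<delta> \<alpha>)"
      using subsetD[OF grid_polys_subset_span_rising g, of \<kappa>] unfolding sspan_def by blast
    have "hahn_inner d \<kappa> N (kernel n x) (rising d \<kappa> \<delta>) = 0"
      if \<delta>: "\<delta> \<in> upto_indices (d + 1) m" for \<delta>
    proof -
      obtain k where "k \<le> m" "\<delta> \<in> multi_indices (d + 1) k"
        using \<delta> unfolding upto_indices_iff by blast
      then show ?thesis
        using hahn_inner_kernel_rising_eq_0[OF x _ _ n] m le_less_trans by blast
    qed
    then have "hahn_inner d \<kappa> N (kernel n x) (\<lambda>\<alpha>. \<Sum>\<delta>\<in>upto_indices (d + 1) m. c \<delta> * rising d \<kappa> \<delta> \<alpha>) = 0"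
      unfolding hahn_inner_sum_right by simp
    moreover have "hahn_inner d \<kappa> N (kernel n x) g =
        hahn_inner d \<kappa> N (kernel n x) (\<lambda>\<alpha>. \<Sum>\<delta>\<in>upto_indices (d + 1) m. c \<delta> * rising d \<kappa> \<delta> \<alpha>)"
      by (rule hahn_inner_cong; (rule refl | erule c))
    ultimately show ?thesis by simp
  qed
  then show ?thesis using kernel_in_grid_polys by (simp add: hahn_space_def)
qed

text \<open>Applied to \<open>rising d \<kappa> \<delta>\<close>, the kernel reproduces the part of top degree.\<close>

lemma kernel_rising_diff:
  assumes n: "n \<le> N" and \<delta>: "\<delta> \<in> upto_indices (d + 1) n"
  shows "(\<lambda>x. hahn_inner d \<kappa> N (kernel n x) (rising d \<kappa> \<delta>) - rising d \<kappa> \<delta> x)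
    \<in> sspan (hahn_grid d N) (falling d) (\<Union>k<n. multi_indices (d + 1) k)" (is "_ \<in> sspan _ _ ?J")
proof -
  obtain m where m: "m \<le> n" "\<delta> \<in> multi_indices (d + 1) m" using \<delta> by (auto simp: upto_indices_iff)
  obtain c where c: "\<And>\<alpha>. rising d \<kappa> \<delta> \<alpha> = (\<Sum>\<epsilon>\<in>upto_indices (d + 1) m. c \<epsilon> * falling d \<epsilon> \<alpha>)"
    using rising_expansion[OF m(2)] by blast
  define c' where "c' \<epsilon> = c \<epsilon> * (eigenvalue n m (\<Sum>i<d + 1. \<epsilon> i) - 1)" for \<epsilon>
  have "hahn_inner d \<kappa> N (kernel n x) (rising d \<kappa> \<delta>) - rising d \<kappa> \<delta> x =
      (\<Sum>\<epsilon>\<in>upto_indices (d + 1) m. c' \<epsilon> * falling d \<epsilon> x)" if "x \<in> hahn_grid d N" for x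
    unfolding hahn_inner_kernel_rising[OF that m(2) m(1) n c] unfolding c c'_def
    by (simp add: algebra_simps sum_subtractf)
  moreover have "(\<Sum>\<epsilon>\<in>upto_indices (d + 1) m. c' \<epsilon> * falling d \<epsilon> x) =
      (\<Sum>\<epsilon>\<in>upto_indices (d + 1) m \<inter> ?J. c' \<epsilon> * falling d \<epsilon> x)" for x
  proof (rule sum.mono_neutral_right)
    show "\<forall>\<epsilon>\<in>upto_indices (d + 1) m - upto_indices (d + 1) m \<inter> ?J. c' \<epsilon> * falling d \<epsilon> x = 0"
    proof
      fix \<epsilon> assume \<epsilon>: "\<epsilon> \<in> upto_indices (d + 1) m - upto_indices (d + 1) m \<inter> ?J"
      then obtain k where k: "k \<le> m" "\<epsilon> \<in> multi_indices (d + 1) k" by (auto simp: upto_indices_iff)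
      \<comment> \<open>Only terms of degree n could be lost. They occur only for m = n, and there
        the eigenvalue 1 makes \<open>c'\<close> vanish.\<close>
      have "\<not> k < n" using \<epsilon> k by blast
      then have "m = n" "k = n" using k m by auto
      then show "c' \<epsilon> * falling d \<epsilon> x = 0"
        using k(2) eigenvalue_eq_1[OF n] by (simp add: c'_def multi_indices_def)
    qed
  qed (auto simp: finite_upto_indices)
  ultimately have "(\<lambda>x. hahn_inner d \<kappa> N (kernel n x) (rising d \<kappa> \<delta>) - rising d \<kappa> \<delta> x)
      \<in> sspan (hahn_grid d N) (falling d) (upto_indices (d + 1) m \<inter> ?J)"
    unfolding sspan_def mem_Collect_eq by (intro exI[of _ c']) simp
  then show ?thesis
    by (rule sspan_mono[rotated 2]) (auto simp: finite_multi_indices)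
qed

lemma kernel_reproducing:
  assumes n: "n \<le> N" and Q: "Q \<in> hahn_space d \<kappa> N n" and x: "x \<in> hahn_grid d N"
  shows "hahn_inner d \<kappa> N (kernel n x) Q = Q x"
proof -
  \<comment> \<open>Degrees strictly below n; for n = 0 this set is empty, and \<open>R\<close> is
    then zero on the grid.\<close>
  let ?J = "\<Union>k<n. multi_indices (d + 1) k"
  define R where "R x = hahn_inner d \<kappa> N (kernel n x) Q - Q x" for x
  obtain c where c: "\<And>\<alpha>. \<alpha> \<in> hahn_grid d N \<Longrightarrow> Q \<alpha> = (\<Sum>\<delta>\<in>upto_indices (d + 1) n. c \<delta> * rising d \<kappa> \<delta> \<alpha>)"
  proof -
    have "Q \<in> sspan (hahn_grid d N) (rising d \<kappa>) (upto_indices (d + 1) n)"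
      using Q grid_polys_subset_span_rising[of d N n \<kappa>] unfolding hahn_space_def by blast
    then show thesis using that unfolding sspan_def by blast
  qed
  have "(\<lambda>x. \<Sum>\<delta>\<in>upto_indices (d + 1) n. c \<delta> *
      (hahn_inner d \<kappa> N (kernel n x) (rising d \<kappa> \<delta>) - rising d \<kappa> \<delta> x)) \<in> sspan (hahn_grid d N) (falling d) ?J"
    by (rule sspan_sum[OF finite_upto_indices kernel_rising_diff[OF n]])
  then have "R \<in> sspan (hahn_grid d N) (falling d) ?J"
  proof (rule sspan_cong)
    fix x assume "x \<in> hahn_grid d N"
    have "hahn_inner d \<kappa> N (kernel n x) Q =
        hahn_inner d \<kappa> N (kernel n x) (\<lambda>\<alpha>. \<Sum>\<delta>\<in>upto_indices (d + 1) n. c \<delta> * rising d \<kappa> \<delta> \<alpha>)"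
      by (rule hahn_inner_cong; (rule refl | erule c))
    then show "(\<Sum>\<delta>\<in>upto_indices (d + 1) n. c \<delta> *
      (hahn_inner d \<kappa> N (kernel n x) (rising d \<kappa> \<delta>) - rising d \<kappa> \<delta> x)) = R x"
      using c[OF \<open>x \<in> _\<close>] unfolding R_def hahn_inner_sum_right
      by (simp add: right_diff_distrib sum_subtractf)
  qed
  then obtain e where e: "\<And>\<alpha>. \<alpha> \<in> hahn_grid d N \<Longrightarrow> R \<alpha> = (\<Sum>\<epsilon>\<in>?J. e \<epsilon> * falling d \<epsilon> \<alpha>)"
    unfolding sspan_def by blast
  have "hahn_inner d \<kappa> N R (falling d \<epsilon>) = 0" if \<epsilon>: "\<epsilon> \<in> ?J" for \<epsilon>
  proof -
    obtain k where k: "k < n" "\<epsilon> \<in> multi_indices (d + 1) k" using \<epsilon> by blast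
    have orth: "hahn_inner d \<kappa> N f (falling d \<epsilon>) = 0" if "f \<in> hahn_space d \<kappa> N n" for f
      using that k(1) falling_in_grid_polys[OF k(2)] by (simp add: hahn_space_def)
    \<comment> \<open>Symmetry exhibits this function as a combination of the sections at grid
      points \<open>a\<close>, each of which is orthogonal to lower degrees.\<close>
    have "(\<lambda>x. hahn_inner d \<kappa> N (kernel n x) Q) =
        (\<lambda>x. \<Sum>a\<in>hahn_grid d N. (weight a * Q a) * kernel n a x)"
      unfolding hahn_inner_eq_wip wip_def by (intro ext sum.cong refl, subst kernel_sym) simp
    then have "hahn_inner d \<kappa> N (\<lambda>x. hahn_inner d \<kappa> N (kernel n x) Q) (falling d \<epsilon>) =
        (\<Sum>a\<in>hahn_grid d N. weight a * Q a * hahn_inner d \<kappa> N (kernel n a) (falling d \<epsilon>))"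
      by (simp only: hahn_inner_sum_left)
    also have "\<dots> = 0"
      by (intro sum.neutral ballI) (simp only: orth[OF kernel_in_hahn_space[OF _ n]] mult_zero_right)
    finally show ?thesis
      using orth[OF Q] by (simp add: hahn_inner_eq_wip R_def[abs_def] wip_diff_left)
  qed
  then have "hahn_inner d \<kappa> N R (\<lambda>\<alpha>. \<Sum>\<epsilon>\<in>?J. e \<epsilon> * falling d \<epsilon> \<alpha>) = 0"
    unfolding hahn_inner_sum_right by simp
  \<comment> \<open>\<open>R\<close> lies in the span of the functions to which it is orthogonal, so
    its norm is 0, and the positive weight forces it to vanish on the grid.\<close>
  moreover have "hahn_inner d \<kappa> N R R = hahn_inner d \<kappa> N R (\<lambda>\<alpha>. \<Sum>\<epsilon>\<in>?J. e \<epsilon> * falling d \<epsilon> \<alpha>)"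
    by (rule hahn_inner_cong; (rule refl | erule e))
  ultimately have "hahn_inner d \<kappa> N R R = 0" by simp
  then have "R x = 0"
    unfolding hahn_inner_eq_wip
    by (rule wip_self_eq_0[OF finite_multi_indices weight_pos _ x])
  then show ?thesis by (simp add: R_def)
qed

section \<open>Identification with the reproducing kernel\<close>

lemma hahn_kernel_eq:
  assumes n: "n \<le> N" and x: "x \<in> hahn_grid d N" and y: "y \<in> hahn_grid d N"
  shows "hahn_kernel d \<kappa> N n x y = kernel n x y"
proof -
  \<comment> \<open>Cut off to 0 outside the grid, as the definite description in
    \<open>hahn_kernel\<close> requires; uniqueness then gives equality of functions.\<close>
  define K where "K x y = (if x \<in> hahn_grid d N \<and> y \<in> hahn_grid d N then kernel n x y else 0)" for x y
  have K: "hahn_inner d \<kappa> N (K x) Q = hahn_inner d \<kappa> N (kernel n x) Q" if "x \<in> hahn_grid d N" for x Q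
    by (rule hahn_inner_cong) (use that in \<open>auto simp: K_def\<close>)
  have mem: "K x \<in> hahn_space d \<kappa> N n" if x: "x \<in> hahn_grid d N" for x
  proof -
    have "K x \<in> grid_polys d N n"
      using kernel_in_grid_polys[of n x] unfolding grid_polys_eq
      by (rule sspan_cong) (use x in \<open>auto simp: K_def\<close>)
    then show ?thesis
      using kernel_in_hahn_space[OF x n] by (simp add: hahn_space_def K[OF x])
  qed
  have "(\<lambda>x. K x y) = K y" for y
    unfolding K_def using kernel_sym by (intro ext) auto
  then have "is_hahn_kernel d \<kappa> N n K"
    using mem kernel_reproducing[OF n] by (simp add: is_hahn_kernel_def K)
  then have "hahn_kernel d \<kappa> N n = K"
    unfolding hahn_kernel_def
    by (intro the1_equality ex1_hahn_kernel[OF \<kappa>]) (auto simp: K_def)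
  then show ?thesis using x y by (simp add: K_def)
qed

end

theorem theorem4p4:
  fixes d N n :: nat and \<kappa> :: "nat \<Rightarrow> real" and x y :: "nat \<Rightarrow> nat"
  assumes "d \<ge> 1"
    and "\<forall>i\<le>d. \<kappa> i > -1"
    and "N \<ge> 1"
    and "n \<le> N"
    and "x \<in> hahn_grid d N"
    and "y \<in> hahn_grid d N"
  shows "hahn_kernel d \<kappa> N n x y =
    pochhammer (- real N) n * pochhammer (vsum d \<kappa> + real d + 1) N * pochhammer (vsum d \<kappa> + real d + 1) n
      / (fact n * pochhammer (vsum d \<kappa> + real d + 1) (N + n))
    * (if n = 0 then 1 else (vsum d \<kappa> + real d + 2 * real n) / (vsum d \<kappa> + real d + real n))
    * (\<Sum>k=0..n. pochhammer (- real n) k * pochhammer (real n + vsum d \<kappa> + real d) k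
          / (pochhammer (- real N) k * pochhammer (- real N) k) * hahn_E d \<kappa> k x y)"
proof -
  interpret hahn d N \<kappa> by unfold_locales (rule assms(2))
  have *: "A - 1 = vsum d \<kappa> + real d" "real n + A - 1 = real n + vsum d \<kappa> + real d"
    by (simp_all add: A_def)
  show ?thesis
    unfolding hahn_kernel_eq[OF assms(4,5,6)] kernel_def kernel_coeff_def *
    unfolding A_def by (rule refl)
qed

end
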